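(* Let $p\in(2,6)$ and $\beta=\frac{p-2}{6-p}$. There exists $\varepsilon>0$ such that the following holds: if $\mathcal K$ is any compact metric graph, $\mathcal G$ is the graph obtained by attaching one halfline to $\mathcal K$, and $\mu>0$ satisfies $$\mu^\beta\,\mathrm{diam}(\mathcal K)+\frac1{\mu^\beta\,\mathrm{length}(\mathcal K)}<\varepsilon,$$ then $\mathcal G$ has no ground state of mass $\mu$.
   Context: A compact metric graph has finitely many vertices and finitely many bounded edges, each identified with an interval $[0,\ell_e]$; $\mathrm{length}(\mathcal K)=\sum_e\ell_e$ is its total length and $\mathrm{diam}(\mathcal K)$ its diameter with respect to the path distance. $H^1_\mu(\mathcal G)$: continuous functions on $\mathcal G$, $H^1$ on each edge, with $\int_{\mathcal G}|u|^2=\mu$. $E(u,\mathcal G)=\frac12\int_{\mathcal G}|u'|^2-\frac1p\int_{\mathcal G}|u|^p$; a ground state of mass $\mu$ is a minimizer of $E(\cdot,\mathcal G)$ on $H^1_\mu(\mathcal G)$. *)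

theory Defs
  imports "HOL-Analysis.Analysis"
begin

text \<open>A compact metric graph is given by a finite vertex set V, a finite nonempty
edge set Ed, an endpoint map ends (edge e goes from fst (ends e) to snd (ends e),
identified with the interval [0, len e]; loops and multiple edges allowed), and
positive edge lengths len.  It is required to be connected.\<close>

fun walk :: "('e \<Rightarrow> 'v \<times> 'v) \<Rightarrow> 'e set \<Rightarrow> 'v \<Rightarrow> ('e \<times> bool) list \<Rightarrow> 'v \<Rightarrow> bool" where
  "walk ends Ed a [] b = (a = b)"
| "walk ends Ed a (ed # w) b =
     (fst ed \<in> Ed \<and>
      (if snd ed then fst (ends (fst ed)) = a \<and> walk ends Ed (snd (ends (fst ed))) w b
       else snd (ends (fst ed)) = a \<and> walk ends Ed (fst (ends (fst ed))) w b))"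

definition walk_len :: "('e \<Rightarrow> real) \<Rightarrow> ('e \<times> bool) list \<Rightarrow> real" where
  "walk_len len w = sum_list (map (\<lambda>ed. len (fst ed)) w)"

definition compact_graph ::
  "'v set \<Rightarrow> 'e set \<Rightarrow> ('e \<Rightarrow> 'v \<times> 'v) \<Rightarrow> ('e \<Rightarrow> real) \<Rightarrow> bool" where
  "compact_graph V Ed ends len \<longleftrightarrow>
     finite V \<and> finite Ed \<and> Ed \<noteq> {} \<and>
     (\<forall>e\<in>Ed. 0 < len e \<and> fst (ends e) \<in> V \<and> snd (ends e) \<in> V) \<and>
     (\<forall>a\<in>V. \<forall>b\<in>V. \<exists>w. walk ends Ed a w b)"

definition graph_length :: "'e set \<Rightarrow> ('e \<Rightarrow> real) \<Rightarrow> real" where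
  "graph_length Ed len = (\<Sum>e\<in>Ed. len e)"

definition vdist :: "('e \<Rightarrow> 'v \<times> 'v) \<Rightarrow> 'e set \<Rightarrow> ('e \<Rightarrow> real) \<Rightarrow> 'v \<Rightarrow> 'v \<Rightarrow> real" where
  "vdist ends Ed len a b = Inf {walk_len len w | w. walk ends Ed a w b}"

definition graph_points :: "'e set \<Rightarrow> ('e \<Rightarrow> real) \<Rightarrow> ('e \<times> real) set" where
  "graph_points Ed len = {(e, t). e \<in> Ed \<and> 0 \<le> t \<and> t \<le> len e}"

text \<open>Path distance between two points of the graph: either move inside the common
edge, or leave the first edge through one of its endpoints, travel between vertices,
and enter the second edge through one of its endpoints.\<close>
definition pdist :: "('e \<Rightarrow> 'v \<times> 'v) \<Rightarrow> 'e set \<Rightarrow> ('e \<Rightarrow> real) \<Rightarrow> 'e \<times> real \<Rightarrow> 'e \<times> real \<Rightarrow> real" where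
  "pdist ends Ed len x y =
     (let e = fst x; s = snd x; f = fst y; t = snd y;
          via = Min ((\<lambda>((a, da), (b, db)). da + vdist ends Ed len a b + db) `
                     ({(fst (ends e), s), (snd (ends e), len e - s)} \<times>
                      {(fst (ends f), t), (snd (ends f), len f - t)}))
      in if e = f then min \<bar>s - t\<bar> via else via)"

definition graph_diam :: "'e set \<Rightarrow> ('e \<Rightarrow> 'v \<times> 'v) \<Rightarrow> ('e \<Rightarrow> real) \<Rightarrow> real" where
  "graph_diam Ed ends len =
     Sup {pdist ends Ed len x y | x y. x \<in> graph_points Ed len \<and> y \<in> graph_points Ed len}"

text \<open>u is in H^1(a,b) with weak derivative g: g is in L^2(a,b) (hence L^1) and
u is its primitive on [a,b] (the continuous representative).\<close>
definition weak_deriv_interval :: "real \<Rightarrow> real \<Rightarrow> (real \<Rightarrow> real) \<Rightarrow> (real \<Rightarrow> real) \<Rightarrow> bool" where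
  "weak_deriv_interval a b u g \<longleftrightarrow>
     set_integrable lborel {a..b} g \<and>
     set_integrable lborel {a..b} (\<lambda>t. (g t)\<^sup>2) \<and>
     (\<forall>x\<in>{a..b}. u x = u a + set_lebesgue_integral lborel {a..x} g)"

definition weak_deriv_halfline :: "(real \<Rightarrow> real) \<Rightarrow> (real \<Rightarrow> real) \<Rightarrow> bool" where
  "weak_deriv_halfline u g \<longleftrightarrow>
     (\<forall>x\<ge>0. weak_deriv_interval 0 x u g) \<and>
     set_integrable lborel {0..} (\<lambda>t. (g t)\<^sup>2) \<and>
     set_integrable lborel {0..} (\<lambda>t. (u t)\<^sup>2)"

text \<open>A function on G together with its derivative: edge functions u e on [0, len e]
with derivatives g e, and a function uh on the halfline [0,\<infinity>) with derivative gh.\<close>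
type_synonym 'e gfun =
  "('e \<Rightarrow> real \<Rightarrow> real) \<times> ('e \<Rightarrow> real \<Rightarrow> real) \<times> (real \<Rightarrow> real) \<times> (real \<Rightarrow> real)"

definition in_H1 ::
  "'e set \<Rightarrow> ('e \<Rightarrow> 'v \<times> 'v) \<Rightarrow> ('e \<Rightarrow> real) \<Rightarrow> 'v \<Rightarrow> 'e gfun \<Rightarrow> bool" where
  "in_H1 Ed ends len v0 w \<longleftrightarrow>
     (case w of (u, g, uh, gh) \<Rightarrow>
        (\<forall>e\<in>Ed. weak_deriv_interval 0 (len e) (u e) (g e)) \<and>
        weak_deriv_halfline uh gh \<and>
        (\<exists>\<phi>. (\<forall>e\<in>Ed. u e 0 = \<phi> (fst (ends e)) \<and> u e (len e) = \<phi> (snd (ends e))) \<and>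
             uh 0 = \<phi> v0))"

definition mass :: "'e set \<Rightarrow> ('e \<Rightarrow> real) \<Rightarrow> 'e gfun \<Rightarrow> real" where
  "mass Ed len w =
     (case w of (u, g, uh, gh) \<Rightarrow>
        (\<Sum>e\<in>Ed. set_lebesgue_integral lborel {0..len e} (\<lambda>t. (u e t)\<^sup>2)) +
        set_lebesgue_integral lborel {0..} (\<lambda>t. (uh t)\<^sup>2))"

definition nls_energy :: "real \<Rightarrow> 'e set \<Rightarrow> ('e \<Rightarrow> real) \<Rightarrow> 'e gfun \<Rightarrow> real" where
  "nls_energy p Ed len w =
     (case w of (u, g, uh, gh) \<Rightarrow>
        1/2 * ((\<Sum>e\<in>Ed. set_lebesgue_integral lborel {0..len e} (\<lambda>t. (g e t)\<^sup>2)) +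
               set_lebesgue_integral lborel {0..} (\<lambda>t. (gh t)\<^sup>2))
        - 1/p * ((\<Sum>e\<in>Ed. set_lebesgue_integral lborel {0..len e} (\<lambda>t. \<bar>u e t\<bar> powr p)) +
                 set_lebesgue_integral lborel {0..} (\<lambda>t. \<bar>uh t\<bar> powr p)))"

definition is_ground_state ::
  "real \<Rightarrow> 'e set \<Rightarrow> ('e \<Rightarrow> 'v \<times> 'v) \<Rightarrow> ('e \<Rightarrow> real) \<Rightarrow> 'v \<Rightarrow> real \<Rightarrow> 'e gfun \<Rightarrow> bool" where
  "is_ground_state p Ed ends len v0 \<mu> w \<longleftrightarrow>
     in_H1 Ed ends len v0 w \<and> mass Ed len w = \<mu> \<and>
     (\<forall>w'. in_H1 Ed ends len v0 w' \<and> mass Ed len w' = \<mu> \<longrightarrow>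
            nls_energy p Ed len w \<le> nls_energy p Ed len w')"

end

theory Submission
  imports Defs
begin

text \<open>
  Put \<open>\<Lambda> = \<mu>\<^sup>\<beta>\<close> and let \<open>E\<close> be the energy of a ground state with restriction \<open>u\<close> to the compact core
  and \<open>uh\<close> to the halfline. Functions supported on the halfline are competitors, so \<open>E\<close> bounds from
  below the energy of every function of mass \<open>\<mu>\<close> on the halfline that vanishes at 0; a tent function
  gives \<open>E \<le> - \<theta> \<mu> \<Lambda>\<^sup>2\<close>, and a Gagliardo--Nirenberg argument bounds the kinetic energy by \<open>C \<mu> \<Lambda>\<^sup>2\<close>.

  Let \<open>m\<close> and \<open>D\<close> be the mass and the kinetic integral on the core. Small diameter and large length
  make \<open>u\<^sup>2 \<le> 2 m / L + 18 d D\<close> there, so the nonlinear term of the core is negligible against \<open>\<Lambda>\<^sup>2 m\<close>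
  and \<open>\<Lambda> (uh 0)\<^sup>2\<close> is negligible against \<open>\<Lambda>\<^sup>2 m + D\<close>. Prepending a short linear ramp to \<open>uh\<close> and
  rescaling it to mass \<open>\<mu>\<close> shows that the halfline carries at least
  \<open>E + \<theta> \<Lambda>\<^sup>2 m - K \<Lambda> (uh 0)\<^sup>2\<close>; hence \<open>m = D = 0\<close>. So \<open>uh\<close> vanishes at 0 and has mass \<open>\<mu>\<close> and
  energy \<open>E\<close>. The same estimate with a short initial interval in place of the core shows that
  \<open>uh\<close> vanishes on that interval, and iterating gives \<open>uh = 0\<close>, which is absurd.
\<close>

section \<open>Weakly differentiable functions on intervals\<close>

lemma halfline_shift:
  fixes f :: "real \<Rightarrow> real"
  shows "set_integrable lborel {s..} f \<longleftrightarrow> set_integrable lborel {0..} (\<lambda>t. f (t + s))"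
    and "(LBINT t:{s..}. f t) = (LBINT t:{0..}. f (t + s))"
proof -
  have eq: "indicator {s..} (s + 1 * t) *\<^sub>R f (s + 1 * t) = indicator {0..} t *\<^sub>R f (t + s)" for t
    by (auto simp: indicator_def add.commute)
  show "set_integrable lborel {s..} f \<longleftrightarrow> set_integrable lborel {0..} (\<lambda>t. f (t + s))"
    unfolding set_integrable_def
    using lborel_integrable_real_affine_iff[of 1 "\<lambda>x. indicator {s..} x *\<^sub>R f x" s, unfolded eq] by simp
  show "(LBINT t:{s..}. f t) = (LBINT t:{0..}. f (t + s))"
    unfolding set_lebesgue_integral_def
    using lborel_integral_real_affine[of 1 "\<lambda>x. indicator {s..} x *\<^sub>R f x" s, unfolded eq] by simp
qed

lemma interval_shift:
  fixes f :: "real \<Rightarrow> real"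
  shows "set_integrable lborel {a + s..b + s} f \<longleftrightarrow> set_integrable lborel {a..b} (\<lambda>t. f (t + s))"
    and "(LBINT t:{a + s..b + s}. f t) = (LBINT t:{a..b}. f (t + s))"
proof -
  have eq: "indicator {a + s..b + s} (s + 1 * t) *\<^sub>R f (s + 1 * t) = indicator {a..b} t *\<^sub>R f (t + s)" for t
    by (auto simp: indicator_def add.commute)
  show "set_integrable lborel {a + s..b + s} f \<longleftrightarrow> set_integrable lborel {a..b} (\<lambda>t. f (t + s))"
    unfolding set_integrable_def
    using lborel_integrable_real_affine_iff[of 1 "\<lambda>x. indicator {a + s..b + s} x *\<^sub>R f x" s, unfolded eq] by simp
  show "(LBINT t:{a + s..b + s}. f t) = (LBINT t:{a..b}. f (t + s))"
    unfolding set_lebesgue_integral_def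
    using lborel_integral_real_affine[of 1 "\<lambda>x. indicator {a + s..b + s} x *\<^sub>R f x" s, unfolded eq] by simp
qed

lemma halfline_split:
  fixes f :: "real \<Rightarrow> real"
  assumes "0 \<le> s"
  shows "set_integrable lborel {0..} f \<longleftrightarrow>
           set_integrable lborel {0..s} f \<and> set_integrable lborel {0..} (\<lambda>t. f (t + s))"
    and "set_integrable lborel {0..} f \<Longrightarrow>
           (LBINT t:{0..}. f t) = (LBINT t:{0..s}. f t) + (LBINT t:{0..}. f (t + s))"
proof -
  have U: "{0..} = {0..s} \<union> {s..}" using assms by auto
  show "set_integrable lborel {0..} f \<longleftrightarrow>
           set_integrable lborel {0..s} f \<and> set_integrable lborel {0..} (\<lambda>t. f (t + s))"
  proof -
    have "set_integrable lborel ({0..s} \<union> {s..}) f \<longleftrightarrow> set_integrable lborel {0..s} f \<and> set_integrable lborel {s..} f"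
      using set_integrable_subset[of lborel "{0..s} \<union> {s..}" f "{0..s}"]
        set_integrable_subset[of lborel "{0..s} \<union> {s..}" f "{s..}"]
        set_integrable_Un[of lborel "{0..s}" f "{s..}"]
      by (auto simp only: sets_lborel Un_upper1 Un_upper2 atLeastAtMost_borel atLeast_borel)
    then show ?thesis by (simp only: U[symmetric] halfline_shift(1)[of s f])
  qed
  assume I: "set_integrable lborel {0..} f"
  then have I1: "set_integrable lborel {0..s} f" and I2: "set_integrable lborel {s..} f"
    using set_integrable_subset[OF I] assms by auto
  \<comment> \<open>The two closed pieces overlap in the point \<open>s\<close>, a null set.\<close>
  have "AE x in lborel. \<not> (x \<in> {0..s} \<and> x \<in> {s..})"
    using AE_lborel_singleton[of s] by (rule AE_mp) (auto intro!: AE_I2)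
  then have "(LBINT t:{0..s} \<union> {s..}. f t) = (LBINT t:{0..s}. f t) + (LBINT t:{s..}. f t)"
    using I1 I2 by (intro set_integral_Un_AE) auto
  then show "(LBINT t:{0..}. f t) = (LBINT t:{0..s}. f t) + (LBINT t:{0..}. f (t + s))"
    by (simp only: U[symmetric] halfline_shift(2)[of s f])
qed

lemma interval_split:
  fixes f :: "real \<Rightarrow> real"
  assumes "a \<le> c" "c \<le> b" "set_integrable lborel {a..b} f"
  shows "(LBINT t:{a..b}. f t) = (LBINT t:{a..c}. f t) + (LBINT t:{c..b}. f t)"
proof -
  have I1: "set_integrable lborel {a..c} f" and I2: "set_integrable lborel {c..b} f"
    using set_integrable_subset[OF assms(3)] assms by auto
  show ?thesis
    using Henstock_Kurzweil_Integration.integral_combine[OF assms(1,2) set_borel_integral_eq_integral(1)[OF assms(3)]]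
    by (simp add: set_borel_integral_eq_integral(2)[OF assms(3)]
        set_borel_integral_eq_integral(2)[OF I1] set_borel_integral_eq_integral(2)[OF I2])
qed

lemma set_integral_nonneg_real:
  fixes f :: "real \<Rightarrow> real"
  assumes "\<And>x. x \<in> A \<Longrightarrow> 0 \<le> f x"
  shows "0 \<le> (LBINT t:A. f t)"
  unfolding set_lebesgue_integral_def
  using assms by (intro Bochner_Integration.integral_nonneg) (auto simp: indicator_def)

lemma set_integrable_const_interval: "set_integrable lborel {a..b::real} (\<lambda>_. c::real)"
  by (intro borel_integrable_atLeastAtMost' continuous_intros)

lemma set_integral_const_interval: "a \<le> b \<Longrightarrow> (LBINT t:{a..b::real}. c::real) = c * (b - a)"
  by (simp add: set_borel_integral_eq_integral(2)[OF set_integrable_const_interval] mult.commute)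

lemma interval_mono:
  fixes f :: "real \<Rightarrow> real"
  assumes "set_integrable lborel B f" "A \<subseteq> B" "A \<in> sets borel" "B \<in> sets borel" "\<And>x. x \<in> B \<Longrightarrow> 0 \<le> f x"
  shows "(LBINT t:A. f t) \<le> (LBINT t:B. f t)"
  unfolding set_lebesgue_integral_def
proof (rule integral_mono)
  show "integrable lborel (\<lambda>t. indicator B t *\<^sub>R f t)"
    using assms(1) by (simp add: set_integrable_def)
  show "integrable lborel (\<lambda>t. indicator A t *\<^sub>R f t)"
    using set_integrable_subset[OF assms(1) _ assms(2)] assms(3) by (simp add: set_integrable_def)
qed (use assms in \<open>auto simp: indicator_def\<close>)

section \<open>Continuity and oscillation of weakly differentiable functions\<close>

lemma weak_deriv_intervalD:
  assumes "weak_deriv_interval a b u g"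
  shows "set_integrable lborel {a..b} g" "set_integrable lborel {a..b} (\<lambda>t. (g t)\<^sup>2)"
    and "a \<le> x \<Longrightarrow> x \<le> b \<Longrightarrow> u x = u a + (LBINT t:{a..x}. g t)"
proof -
  note W = assms[unfolded weak_deriv_interval_def]
  show "set_integrable lborel {a..b} g" "set_integrable lborel {a..b} (\<lambda>t. (g t)\<^sup>2)"
    using W by blast+
  show "u x = u a + (LBINT t:{a..x}. g t)" if "a \<le> x" "x \<le> b"
    using conjunct2[OF conjunct2[OF W]] that by (meson atLeastAtMost_iff)
qed

lemma weak_deriv_diff:
  assumes "weak_deriv_interval a b u g" "a \<le> x" "x \<le> y" "y \<le> b"
  shows "u y - u x = (LBINT t:{x..y}. g t)"
proof -
  have I: "set_integrable lborel {a..y} g"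
    using set_integrable_subset[OF weak_deriv_intervalD(1)[OF assms(1)]] assms(4) by simp
  have "u y = u a + (LBINT t:{a..y}. g t)" "u x = u a + (LBINT t:{a..x}. g t)"
    using assms(2-4) by (intro weak_deriv_intervalD(3)[OF assms(1)]; linarith)+
  with interval_split[OF assms(2,3) I] show ?thesis by simp
qed

lemma weak_deriv_subinterval:
  assumes "weak_deriv_interval a b u g" "a \<le> c" "d \<le> b"
  shows "weak_deriv_interval c d u g"
proof -
  have "u x = u c + (LBINT t:{c..x}. g t)" if "x \<in> {c..d}" for x
    using weak_deriv_diff[OF assms(1), of c x] that assms(2,3) by auto
  moreover have "set_integrable lborel {c..d} g" "set_integrable lborel {c..d} (\<lambda>t. (g t)\<^sup>2)"
    using assms(2,3) by (auto intro: set_integrable_subset weak_deriv_intervalD[OF assms(1)])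
  ultimately show ?thesis unfolding weak_deriv_interval_def by blast
qed

lemma weak_deriv_continuous:
  assumes "weak_deriv_interval a b u g"
  shows "continuous_on {a..b} u"
proof -
  have I: "set_integrable lborel {a..b} g" by (rule weak_deriv_intervalD[OF assms])
  have "continuous_on {a..b} (\<lambda>x. u a + integral {a..x} g)"
    by (intro continuous_intros indefinite_integral_continuous_1 set_borel_integral_eq_integral(1) I)
  moreover have "u x = u a + integral {a..x} g" if "x \<in> {a..b}" for x
    using weak_deriv_intervalD(3)[OF assms, of x] that
      set_borel_integral_eq_integral(2)[OF set_integrable_subset[OF I, of "{a..x}"]] by auto
  ultimately show ?thesis by (metis (no_types, lifting) continuous_on_cong)
qed

text \<open>Cauchy--Schwarz, by integrating the square of \<open>g\<close> minus its mean.\<close>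

lemma weak_deriv_osc:
  assumes W: "weak_deriv_interval a b u g" and "a \<le> b"
  shows "(u b - u a)\<^sup>2 \<le> (b - a) * (LBINT t:{a..b}. (g t)\<^sup>2)"
proof (cases "a = b")
  case False
  with assms have ab: "a < b" by simp
  define c where "c = (u b - u a) / (b - a)"
  have I: "set_integrable lborel {a..b} g" "set_integrable lborel {a..b} (\<lambda>t. (g t)\<^sup>2)"
    by (rule weak_deriv_intervalD[OF W])+
  have G: "(LBINT t:{a..b}. g t) = u b - u a" using weak_deriv_diff[OF W, of a b] assms(2) by simp
  have "0 \<le> (LBINT t:{a..b}. (g t)\<^sup>2 - 2 * c * g t + c\<^sup>2)"
  proof (rule set_integral_nonneg_real)
    show "0 \<le> (g t)\<^sup>2 - 2 * c * g t + c\<^sup>2" for t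
      using zero_le_power2[of "g t - c"] by (simp add: power2_diff mult.commute mult.left_commute)
  qed
  also have "\<dots> = (LBINT t:{a..b}. (g t)\<^sup>2) - 2 * c * (u b - u a) + c\<^sup>2 * (b - a)"
    using I set_integrable_const_interval by (simp add: G set_integral_const_interval assms(2))
  also have "\<dots> = (LBINT t:{a..b}. (g t)\<^sup>2) - (u b - u a)\<^sup>2 / (b - a)"
  proof -
    have "c * (u b - u a) = (u b - u a)\<^sup>2 / (b - a)" "c\<^sup>2 * (b - a) = (u b - u a)\<^sup>2 / (b - a)"
      unfolding c_def using ab by (simp_all add: power2_eq_square)
    then show ?thesis by (simp add: mult.assoc)
  qed
  finally have "(u b - u a)\<^sup>2 / (b - a) \<le> (LBINT t:{a..b}. (g t)\<^sup>2)" by simp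
  then show ?thesis using ab by (simp add: pos_divide_le_eq mult.commute)
qed simp

lemma weak_deriv_osc_le:
  assumes W: "weak_deriv_interval a b u g" and "a \<le> x" "x \<le> y" "y \<le> b" "y - x \<le> d"
  shows "(u y - u x)\<^sup>2 \<le> d * (LBINT t:{a..b}. (g t)\<^sup>2)"
proof -
  have "(u y - u x)\<^sup>2 \<le> (y - x) * (LBINT t:{x..y}. (g t)\<^sup>2)"
    by (rule weak_deriv_osc[OF weak_deriv_subinterval[OF W assms(2,4)] assms(3)])
  also have "\<dots> \<le> d * (LBINT t:{a..b}. (g t)\<^sup>2)"
  proof (rule mult_mono)
    show "(LBINT t:{x..y}. (g t)\<^sup>2) \<le> (LBINT t:{a..b}. (g t)\<^sup>2)"
      using assms(2-4) by (intro interval_mono weak_deriv_intervalD(2)[OF W]) auto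
    show "0 \<le> (LBINT t:{x..y}. (g t)\<^sup>2)" by (rule set_integral_nonneg_real) simp
  qed (use assms(2-5) in auto)
  finally show ?thesis .
qed

text \<open>Formally \<open>(u^2)' = 2 u g\<close>, and \<open>2 |u g|\<close> is at most
  \<open>u^2 / h + h g^2\<close>. Instead of a product rule, the estimate is proved on short
  intervals, where \<open>u\<close> is nearly constant, and then added up. The error made by
  freezing \<open>u\<close> costs the factor 2 in \<open>2 / h\<close>.\<close>

lemma weak_deriv_square_diff:
  assumes W: "weak_deriv_interval a b u g" and "a \<le> b" "0 < h"
  shows "\<bar>(u b)\<^sup>2 - (u a)\<^sup>2\<bar> \<le> 2 / h * (LBINT t:{a..b}. (u t)\<^sup>2) + h * (LBINT t:{a..b}. (g t)\<^sup>2)"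
proof (rule field_le_epsilon)
  fix e :: real assume "0 < e"
  \<comment> \<open>\<open>\<eta>\<close> is the oscillation of \<open>u\<close> allowed on a short
    interval. Its size makes the accumulated error \<open>2 / h * \<eta>\<^sup>2 * (b - a)\<close>
    at most \<open>e\<close>; the \<open>+ 1\<close> keeps the denominator positive when
    \<open>a = b\<close>.\<close>
  define \<eta> where "\<eta> = sqrt (e * h / (2 * (b - a + 1)))"
  have eta: "0 < \<eta>" "2 / h * \<eta>\<^sup>2 * (b - a) \<le> e"
  proof -
    show "0 < \<eta>" using assms \<open>0 < e\<close> by (simp add: \<eta>_def)
    have "\<eta>\<^sup>2 = e * h / (2 * (b - a + 1))" using assms \<open>0 < e\<close> by (simp add: \<eta>_def)
    moreover have "2 / h * (e * h / (2 * r)) * (b - a) = e * ((b - a) / r)" if "r > 0" for r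
      using that assms(3) by (simp add: field_simps)
    moreover have "b - a + 1 > 0" using assms(2) by simp
    ultimately have "2 / h * \<eta>\<^sup>2 * (b - a) = e * ((b - a) / (b - a + 1))"
      by metis
    also have "\<dots> \<le> e * 1" using assms \<open>0 < e\<close> by (intro mult_left_mono) auto
    finally show "2 / h * \<eta>\<^sup>2 * (b - a) \<le> e" by simp
  qed
  have C: "continuous_on {a..b} u" by (rule weak_deriv_continuous[OF W])
  have Ig: "set_integrable lborel {a..b} g" "set_integrable lborel {a..b} (\<lambda>t. (g t)\<^sup>2)"
    by (rule weak_deriv_intervalD[OF W])+
  have Iu: "set_integrable lborel {a..b} (\<lambda>t. (u t)\<^sup>2)"
    by (intro borel_integrable_atLeastAtMost' continuous_intros C)
  let ?f = "\<lambda>t. 2 / h * (u t)\<^sup>2 + 2 / h * \<eta>\<^sup>2 + h * (g t)\<^sup>2"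
  have If: "set_integrable lborel {a..b} ?f"
    using Ig Iu set_integrable_const_interval by (intro set_integral_add(1)) auto
  have "a \<le> a \<longrightarrow> b \<le> b \<longrightarrow> \<bar>(u b)\<^sup>2 - (u a)\<^sup>2\<bar> \<le> (LBINT t:{a..b}. ?f t)"
    using \<open>a \<le> b\<close>
  \<comment> \<open>Bisection: the integral bound is additive under concatenation, so it suffices to
    prove it on all short intervals around each point.\<close>
  proof (induction rule: Bolzano[where P = "\<lambda>c d. a \<le> c \<longrightarrow> d \<le> b \<longrightarrow> \<bar>(u d)\<^sup>2 - (u c)\<^sup>2\<bar> \<le> (LBINT t:{c..d}. ?f t)"])
    case (trans x y z)
    show ?case
    proof (intro impI)
      assume "a \<le> x" "z \<le> b"
      then have "set_integrable lborel {x..z} ?f"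
        using set_integrable_subset[OF If] by auto
      from interval_split[OF _ _ this, of y] trans \<open>a \<le> x\<close> \<open>z \<le> b\<close>
      show "\<bar>(u z)\<^sup>2 - (u x)\<^sup>2\<bar> \<le> (LBINT t:{x..z}. ?f t)" by auto
    qed
  next
    case (local x)
    have "continuous (at x within {a..b}) u"
      using C local by (auto simp: continuous_on_eq_continuous_within)
    then obtain d where d: "d > 0" "\<And>y. y \<in> {a..b} \<Longrightarrow> \<bar>y - x\<bar> < d \<Longrightarrow> \<bar>u y - u x\<bar> < \<eta> / 2"
      unfolding continuous_within_eps_delta dist_real_def using eta(1) by (meson half_gt_zero)
    show ?case
    proof (intro exI[of _ d] conjI allI impI d(1))
      fix y z assume yz: "y \<le> x \<and> x \<le> z \<and> z - y < d" "a \<le> y" "z \<le> b"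
      have "\<bar>u t - u x\<bar> < \<eta> / 2" if "t \<in> {y..z}" for t
        by (intro d(2)) (use that yz in auto)
      then have near: "\<bar>u t - u r\<bar> \<le> \<eta>" if "t \<in> {y..z}" "r \<in> {y..z}" for t r
        using that by (smt (verit) field_sum_of_halves)
      have Is: "set_integrable lborel {y..z} g" "set_integrable lborel {y..z} ?f"
        using set_integrable_subset[OF Ig(1)] set_integrable_subset[OF If] yz by auto
      have "\<bar>(u z)\<^sup>2 - (u y)\<^sup>2\<bar> = \<bar>(u z + u y) * (LBINT t:{y..z}. g t)\<bar>"
        using weak_deriv_diff[OF W, of y z] yz by (simp add: power2_eq_square algebra_simps)
      also have "\<dots> = \<bar>LBINT t:{y..z}. (u z + u y) * g t\<bar>" by simp
      also have "\<dots> \<le> (LBINT t:{y..z}. \<bar>(u z + u y) * g t\<bar>)"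
      proof -
        have "set_integrable lborel {y..z} (\<lambda>t. (u z + u y) * g t)" using Is by simp
        from set_integral_norm_bound[OF this] show ?thesis by (simp only: real_norm_def)
      qed
      also have "\<dots> \<le> (LBINT t:{y..z}. ?f t)"
      proof (rule set_integral_mono)
        show "set_integrable lborel {y..z} (\<lambda>t. \<bar>(u z + u y) * g t\<bar>)"
          using Is by (intro set_integrable_abs) simp
        fix t assume t: "t \<in> {y..z}"
        have "\<bar>u z + u y\<bar> \<le> 2 * (\<bar>u t\<bar> + \<eta>)" using near[OF t, of z] near[OF t, of y] yz by auto
        then have "\<bar>(u z + u y) * g t\<bar> \<le> 2 * (\<bar>u t\<bar> + \<eta>) * \<bar>g t\<bar>"
          by (simp add: abs_mult mult_right_mono)
        also have "\<dots> \<le> 1 / h * (\<bar>u t\<bar> + \<eta>)\<^sup>2 + h * (g t)\<^sup>2"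
        proof -
          have "0 \<le> 1 / h * ((\<bar>u t\<bar> + \<eta>) - h * \<bar>g t\<bar>)\<^sup>2" using \<open>0 < h\<close> by simp
          also have "\<dots> = 1 / h * (\<bar>u t\<bar> + \<eta>)\<^sup>2 - 2 * (\<bar>u t\<bar> + \<eta>) * \<bar>g t\<bar> + h * (g t)\<^sup>2"
            using \<open>0 < h\<close> by (simp add: power2_diff field_simps power2_eq_square)
          finally show ?thesis by simp
        qed
        also have "1 / h * (\<bar>u t\<bar> + \<eta>)\<^sup>2 \<le> 1 / h * (2 * (u t)\<^sup>2 + 2 * \<eta>\<^sup>2)"
        proof -
          have "0 \<le> (\<bar>u t\<bar> - \<eta>)\<^sup>2" by simp
          then have "(\<bar>u t\<bar> + \<eta>)\<^sup>2 \<le> 2 * (u t)\<^sup>2 + 2 * \<eta>\<^sup>2"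
            by (simp add: power2_sum power2_diff)
          then show ?thesis using \<open>0 < h\<close> by (intro mult_left_mono) auto
        qed
        finally show "\<bar>(u z + u y) * g t\<bar> \<le> ?f t" by (simp add: distrib_left)
      qed (rule Is)
      finally show "\<bar>(u z)\<^sup>2 - (u y)\<^sup>2\<bar> \<le> (LBINT t:{y..z}. ?f t)" .
    qed
  qed
  then have "\<bar>(u b)\<^sup>2 - (u a)\<^sup>2\<bar> \<le> (LBINT t:{a..b}. ?f t)" by simp
  also have "\<dots> = 2 / h * (LBINT t:{a..b}. (u t)\<^sup>2) + 2 / h * \<eta>\<^sup>2 * (b - a) + h * (LBINT t:{a..b}. (g t)\<^sup>2)"
  proof -
    have J: "set_integrable lborel {a..b} (\<lambda>t. 2 / h * (u t)\<^sup>2)" "set_integrable lborel {a..b} (\<lambda>t. h * (g t)\<^sup>2)"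
      using Iu Ig by (intro set_integrable_mult_right; simp)+
    show ?thesis
      by (subst set_integral_add(2)[OF set_integral_add(1)[OF J(1) set_integrable_const_interval] J(2)],
          subst set_integral_add(2)[OF J(1) set_integrable_const_interval])
        (simp only: set_integral_mult_right set_integral_const_interval[OF \<open>a \<le> b\<close>])
  qed
  finally show "\<bar>(u b)\<^sup>2 - (u a)\<^sup>2\<bar> \<le> 2 / h * (LBINT t:{a..b}. (u t)\<^sup>2) + h * (LBINT t:{a..b}. (g t)\<^sup>2) + e"
    using eta(2) by linarith
qed

section \<open>Changing, translating and gluing functions on intervals\<close>

lemma interval_cong_open:
  fixes f f' :: "real \<Rightarrow> real"
  assumes "\<And>x. a \<le> x \<Longrightarrow> x < b \<Longrightarrow> f x = f' x"
  shows "set_integrable lborel {a..b} f \<longleftrightarrow> set_integrable lborel {a..b} f'"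
    and "(LBINT t:{a..b}. f t) = (LBINT t:{a..b}. f' t)"
proof -
  have D: "set_integrable lborel {a..b} h \<longleftrightarrow> set_integrable lborel {a..<b} h"
    "(LBINT t:{a..b}. h t) = (LBINT t:{a..<b}. h t)" for h :: "real \<Rightarrow> real"
    by (rule set_integrable_discrete_difference[of "{b}"] set_integral_discrete_difference[of "{b}"]; auto)+
  show "set_integrable lborel {a..b} f \<longleftrightarrow> set_integrable lborel {a..b} f'"
    unfolding D using assms by (intro set_integrable_cong) auto
  show "(LBINT t:{a..b}. f t) = (LBINT t:{a..b}. f' t)"
    unfolding D using assms by (intro set_lebesgue_integral_cong) auto
qed

text \<open>The derivatives may differ at \<open>b\<close>, which gluing requires: at the junction,
  \<open>prepend\<close> takes the value of the second function.\<close>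

lemma weak_deriv_interval_cong:
  assumes W: "weak_deriv_interval a b u g"
    and "\<And>x. a \<le> x \<Longrightarrow> x \<le> b \<Longrightarrow> u x = u' x" "\<And>x. a \<le> x \<Longrightarrow> x < b \<Longrightarrow> g x = g' x"
  shows "weak_deriv_interval a b u' g'"
  unfolding weak_deriv_interval_def
proof (intro conjI ballI)
  show "set_integrable lborel {a..b} g'"
    using interval_cong_open(1)[of a b g g'] assms(3) weak_deriv_intervalD(1)[OF W] by blast
  show "set_integrable lborel {a..b} (\<lambda>t. (g' t)\<^sup>2)"
    using interval_cong_open(1)[of a b "\<lambda>t. (g t)\<^sup>2" "\<lambda>t. (g' t)\<^sup>2"] assms(3) weak_deriv_intervalD(2)[OF W] by simp
  fix x assume x: "x \<in> {a..b}"
  have "(LBINT t:{a..x}. g t) = (LBINT t:{a..x}. g' t)"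
    using assms(3) x by (intro interval_cong_open(2)) auto
  then show "u' x = u' a + (LBINT t:{a..x}. g' t)"
    using weak_deriv_intervalD(3)[OF W, of x] x assms(2)[of x] assms(2)[of a] by auto
qed

lemma weak_deriv_interval_shift:
  "weak_deriv_interval (a + s) (b + s) u g \<longleftrightarrow> weak_deriv_interval a b (\<lambda>t. u (t + s)) (\<lambda>t. g (t + s))"
proof -
  have "(\<forall>x\<in>{a+s..b+s}. u x = u (a+s) + (LBINT t:{a+s..x}. g t)) \<longleftrightarrow>
    (\<forall>x\<in>{a..b}. u (x + s) = u (a + s) + (LBINT t:{a..x}. g (t+s)))"
    (is "?L \<longleftrightarrow> ?R")
  proof
    assume ?L then show ?R
      by (metis (no_types, lifting) add_le_cancel_right atLeastAtMost_iff interval_shift(2))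
  next
    assume R: ?R
    show ?L
    proof
      fix x assume "x \<in> {a+s..b+s}"
      then have "x - s \<in> {a..b}" by auto
      from bspec[OF R this] show "u x = u (a+s) + (LBINT t:{a+s..x}. g t)"
        using interval_shift(2)[of a s "x - s" g] by simp
    qed
  qed
  then show ?thesis
    unfolding weak_deriv_interval_def interval_shift(1) by simp
qed

lemma weak_deriv_join:
  assumes "weak_deriv_interval a c u g" "weak_deriv_interval c b u g" "a \<le> c" "c \<le> b"
  shows "weak_deriv_interval a b u g"
  unfolding weak_deriv_interval_def
proof (intro conjI ballI)
  have U: "{a..b} = {a..c} \<union> {c..b}" using assms(3,4) by auto
  show I: "set_integrable lborel {a..b} g" "set_integrable lborel {a..b} (\<lambda>t. (g t)\<^sup>2)"
    unfolding U
    by (intro set_integrable_Un weak_deriv_intervalD(1,2)[OF assms(1)] weak_deriv_intervalD(1,2)[OF assms(2)]; simp)+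
  fix x assume x: "x \<in> {a..b}"
  show "u x = u a + (LBINT t:{a..x}. g t)"
  proof (cases "x \<le> c")
    case True then show ?thesis by (intro weak_deriv_intervalD(3)[OF assms(1)]) (use x in auto)
  next
    case False
    have "set_integrable lborel {a..x} g" using set_integrable_subset[OF I(1)] x by auto
    then show ?thesis
      using interval_split[of a c x g] weak_deriv_intervalD(3)[OF assms(1), of c]
        weak_deriv_intervalD(3)[OF assms(2), of x] False x assms(3) by auto
  qed
qed

section \<open>Functions on the halfline\<close>

lemma weak_deriv_halflineD:
  assumes "weak_deriv_halfline u g"
  shows "0 \<le> a \<Longrightarrow> weak_deriv_interval a x u g"
    and "set_integrable lborel {0..} (\<lambda>t. (g t)\<^sup>2)" "set_integrable lborel {0..} (\<lambda>t. (u t)\<^sup>2)"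
proof -
  show "weak_deriv_interval a x u g" if "0 \<le> a"
    \<comment> \<open>\<open>max x 0\<close> also covers negative \<open>x\<close>, for which
      \<open>{a..x}\<close> is empty.\<close>
    using assms weak_deriv_subinterval[of 0 "max x 0" u g a x] that
    by (auto simp: weak_deriv_halfline_def)
qed (use assms in \<open>auto simp: weak_deriv_halfline_def\<close>)

lemma weak_deriv_halfline_shift:
  assumes "weak_deriv_halfline u g" "0 \<le> s"
  shows "weak_deriv_halfline (\<lambda>t. u (t + s)) (\<lambda>t. g (t + s))"
proof -
  have "weak_deriv_interval 0 x (\<lambda>t. u (t + s)) (\<lambda>t. g (t + s))" if "0 \<le> x" for x
    using weak_deriv_interval_shift[of 0 s x u g] weak_deriv_halflineD(1)[OF assms(1)] assms(2) by simp
  then show ?thesis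
    using halfline_split(1)[OF assms(2), of "\<lambda>t. (u t)\<^sup>2"] halfline_split(1)[OF assms(2), of "\<lambda>t. (g t)\<^sup>2"]
      weak_deriv_halflineD(2,3)[OF assms(1)] by (simp add: weak_deriv_halfline_def)
qed

lemma weak_deriv_halfline_join:
  assumes "weak_deriv_interval 0 s u g" "weak_deriv_halfline (\<lambda>t. u (t + s)) (\<lambda>t. g (t + s))" "0 \<le> s"
  shows "weak_deriv_halfline u g"
proof -
  have "weak_deriv_interval 0 x u g" if "0 \<le> x" for x
  proof -
    have "weak_deriv_interval s (s + x) u g"
      using weak_deriv_interval_shift[of 0 s x u g] weak_deriv_halflineD(1)[OF assms(2)] by (simp add: add.commute)
    then have "weak_deriv_interval 0 (s + x) u g"
      using weak_deriv_join[OF assms(1)] assms(3) that by simp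
    then show ?thesis by (rule weak_deriv_subinterval) (use assms(3) in auto)
  qed
  moreover have "set_integrable lborel {0..s} (\<lambda>t. (u t)\<^sup>2)"
    by (intro borel_integrable_atLeastAtMost' continuous_intros weak_deriv_continuous[OF assms(1)])
  ultimately show ?thesis
    using halfline_split(1)[OF assms(3), of "\<lambda>t. (u t)\<^sup>2"] halfline_split(1)[OF assms(3), of "\<lambda>t. (g t)\<^sup>2"]
      weak_deriv_halflineD(2,3)[OF assms(2)] weak_deriv_intervalD(2)[OF assms(1)]
    by (simp add: weak_deriv_halfline_def)
qed

section \<open>Prepending a piece to a function on the halfline\<close>

definition prepend :: "real \<Rightarrow> (real \<Rightarrow> real) \<Rightarrow> (real \<Rightarrow> real) \<Rightarrow> real \<Rightarrow> real" where
  "prepend s f u t = (if t < s then f t else u (t - s))"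

lemma weak_deriv_halfline_cong:
  assumes "weak_deriv_halfline u g" "\<And>x. 0 \<le> x \<Longrightarrow> u x = u' x" "\<And>x. 0 \<le> x \<Longrightarrow> g x = g' x"
  shows "weak_deriv_halfline u' g'"
proof -
  have "weak_deriv_interval 0 x u' g'" for x
    by (rule weak_deriv_interval_cong[OF weak_deriv_halflineD(1)[OF assms(1)]]) (use assms in auto)
  moreover have "set_integrable lborel {0..} (\<lambda>t. (g' t)\<^sup>2)"
    using weak_deriv_halflineD(2)[OF assms(1)] assms(3)
      set_integrable_cong[of lborel lborel "{0..}" "{0..}" "\<lambda>t. (g t)\<^sup>2" "\<lambda>t. (g' t)\<^sup>2"] by simp
  moreover have "set_integrable lborel {0..} (\<lambda>t. (u' t)\<^sup>2)"
    using weak_deriv_halflineD(3)[OF assms(1)] assms(2)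
      set_integrable_cong[of lborel lborel "{0..}" "{0..}" "\<lambda>t. (u t)\<^sup>2" "\<lambda>t. (u' t)\<^sup>2"] by simp
  ultimately show ?thesis by (simp add: weak_deriv_halfline_def)
qed

lemma weak_deriv_prepend:
  assumes "weak_deriv_interval 0 s f f'" "weak_deriv_halfline u g" "f s = u 0" "0 \<le> s"
  shows "weak_deriv_halfline (prepend s f u) (prepend s f' g)"
proof (rule weak_deriv_halfline_join[OF _ _ assms(4)])
  show "weak_deriv_interval 0 s (prepend s f u) (prepend s f' g)"
    by (rule weak_deriv_interval_cong[OF assms(1)]) (use assms(3) in \<open>auto simp: prepend_def\<close>)
  show "weak_deriv_halfline (\<lambda>t. prepend s f u (t + s)) (\<lambda>t. prepend s f' g (t + s))"
    by (rule weak_deriv_halfline_cong[OF assms(2)]) (auto simp: prepend_def)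
qed

lemma integral_prepend:
  fixes F :: "real \<Rightarrow> real"
  assumes "0 \<le> s" "set_integrable lborel {0..s} (\<lambda>t. F (f t))" "set_integrable lborel {0..} (\<lambda>t. F (u t))"
  shows "set_integrable lborel {0..} (\<lambda>t. F (prepend s f u t))"
    and "(LBINT t:{0..}. F (prepend s f u t)) = (LBINT t:{0..s}. F (f t)) + (LBINT t:{0..}. F (u t))"
proof -
  have I1: "set_integrable lborel {0..s} (\<lambda>t. F (prepend s f u t))"
    using interval_cong_open(1)[of 0 s "\<lambda>t. F (prepend s f u t)" "\<lambda>t. F (f t)"] assms by (simp add: prepend_def)
  have E1: "(LBINT t:{0..s}. F (prepend s f u t)) = (LBINT t:{0..s}. F (f t))"
    by (rule interval_cong_open(2)) (simp add: prepend_def)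
  have I2: "set_integrable lborel {0..} (\<lambda>t. F (prepend s f u (t + s)))"
    using assms(3) by (subst set_integrable_cong[where f' = "\<lambda>t. F (u t)"]) (auto simp: prepend_def)
  have E2: "(LBINT t:{0..}. F (prepend s f u (t + s))) = (LBINT t:{0..}. F (u t))"
    by (rule set_lebesgue_integral_cong) (auto simp: prepend_def)
  show I: "set_integrable lborel {0..} (\<lambda>t. F (prepend s f u t))"
    using halfline_split(1)[OF assms(1)] I1 I2 by blast
  show "(LBINT t:{0..}. F (prepend s f u t)) = (LBINT t:{0..s}. F (f t)) + (LBINT t:{0..}. F (u t))"
    using halfline_split(2)[OF assms(1) I] E1 E2 by simp
qed

lemma weak_deriv_linear:
  assumes "0 \<le> s"
  shows "weak_deriv_interval 0 s (\<lambda>t. c + k * t) (\<lambda>_. k)"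
  unfolding weak_deriv_interval_def
  using set_integrable_const_interval by (auto simp: set_integral_const_interval)

lemma integral_linear_square:
  fixes s c k :: real
  assumes "0 \<le> s"
  shows "(LBINT t:{0..s}. (c + k * t)\<^sup>2) = c\<^sup>2 * s + c * k * s\<^sup>2 + k\<^sup>2 * s ^ 3 / 3"
proof -
  have "((\<lambda>t. (c + k * t)\<^sup>2) has_integral
      (c\<^sup>2 * s + c * k * s\<^sup>2 + k\<^sup>2 * s ^ 3 / 3) - (c\<^sup>2 * 0 + c * k * 0\<^sup>2 + k\<^sup>2 * 0 ^ 3 / 3)) {0..s}"
    by (rule fundamental_theorem_of_calculus[OF assms])
      (auto intro!: derivative_eq_intros simp flip: has_real_derivative_iff_has_vector_derivative
        simp: power2_eq_square algebra_simps)
  moreover have "set_integrable lborel {0..s} (\<lambda>t. (c + k * t)\<^sup>2)"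
    by (intro borel_integrable_atLeastAtMost' continuous_intros)
  ultimately show ?thesis
    by (simp add: set_borel_integral_eq_integral(2) integral_unique)
qed

lemma weak_deriv_halfline_scale:
  assumes "weak_deriv_halfline u g"
  shows "weak_deriv_halfline (\<lambda>t. c * u t) (\<lambda>t. c * g t)"
proof -
  have "weak_deriv_interval 0 x (\<lambda>t. c * u t) (\<lambda>t. c * g t)" for x
    unfolding weak_deriv_interval_def
  proof (intro conjI ballI)
    note W = weak_deriv_halflineD(1)[OF assms, of 0 x]
    show "set_integrable lborel {0..x} (\<lambda>t. c * g t)" "set_integrable lborel {0..x} (\<lambda>t. (c * g t)\<^sup>2)"
      using weak_deriv_intervalD(1,2)[OF W] by (simp_all add: power_mult_distrib)
    show "c * u y = c * u 0 + (LBINT t:{0..y}. c * g t)" if "y \<in> {0..x}" for y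
      using weak_deriv_intervalD(3)[OF W, of y] that by (simp add: algebra_simps)
  qed
  then show ?thesis
    using weak_deriv_halflineD(2,3)[OF assms] by (simp add: weak_deriv_halfline_def power_mult_distrib)
qed

section \<open>Bounds for the nonlinear term and for the supremum\<close>

lemma powr_eq_square_powr:
  fixes x :: real
  shows "p > 2 \<Longrightarrow> \<bar>x\<bar> powr p = (x\<^sup>2) powr ((p - 2) / 2) * x\<^sup>2"
proof (cases "x = 0")
  case False
  have sq: "x\<^sup>2 = \<bar>x\<bar> powr 2" using False by simp
  have "(x\<^sup>2) powr ((p - 2) / 2) * x\<^sup>2 = \<bar>x\<bar> powr (p - 2) * \<bar>x\<bar> powr 2"
    unfolding sq powr_powr by (intro arg_cong2[of _ _ _ _ "(*)"] arg_cong2[of _ _ _ _ "(powr)"]) simp_all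
  also have "\<dots> = \<bar>x\<bar> powr p" unfolding powr_add[symmetric] by simp
  finally show ?thesis by simp
qed simp

text \<open>Writing \<open>\<bar>u\<bar> powr p\<close> as a power of \<open>u^2\<close> times
  \<open>u^2\<close> splits off a factor controlled by \<open>B\<close> and leaves the mass.\<close>

lemma powr_integral_bound:
  fixes u :: "real \<Rightarrow> real"
  assumes "p > 2" "A \<in> sets borel" "set_integrable lborel A (\<lambda>t. (u t)\<^sup>2)" "\<And>t. t \<in> A \<Longrightarrow> (u t)\<^sup>2 \<le> B"
  shows "set_integrable lborel A (\<lambda>t. \<bar>u t\<bar> powr p)"
    and "(LBINT t:A. \<bar>u t\<bar> powr p) \<le> B powr ((p - 2) / 2) * (LBINT t:A. (u t)\<^sup>2)"
proof -
  have le: "\<bar>u t\<bar> powr p \<le> B powr ((p - 2) / 2) * (u t)\<^sup>2" if "t \<in> A" for t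
    unfolding powr_eq_square_powr[OF assms(1)]
    using assms(1,4) that by (intro mult_right_mono powr_mono2) auto
  have I: "set_integrable lborel A (\<lambda>t. B powr ((p - 2) / 2) * (u t)\<^sup>2)" using assms(3) by simp
  \<comment> \<open>Measurability is available only for \<open>u^2\<close> on \<open>A\<close>, so
    the integrand is expressed through it.\<close>
  have eq: "indicator A t *\<^sub>R \<bar>u t\<bar> powr p = (indicator A t *\<^sub>R (u t)\<^sup>2) powr (p / 2)" for t
  proof -
    have "\<bar>u t\<bar> powr p = ((u t)\<^sup>2) powr (p / 2)"
      using powr_powr[of "\<bar>u t\<bar>" 2 "p/2"] by (cases "u t = 0") auto
    then show ?thesis by (auto simp: indicator_def)
  qed
  show J: "set_integrable lborel A (\<lambda>t. \<bar>u t\<bar> powr p)"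
  proof (rule set_integrable_bound[OF I])
    have "(\<lambda>t. indicator A t *\<^sub>R (u t)\<^sup>2) \<in> borel_measurable lborel"
      using assms(3) unfolding set_integrable_def by (rule borel_measurable_integrable)
    then show "set_borel_measurable lborel A (\<lambda>t. \<bar>u t\<bar> powr p)"
      unfolding set_borel_measurable_def eq by measurable
    show "AE t in lborel. t \<in> A \<longrightarrow> norm (\<bar>u t\<bar> powr p) \<le> norm (B powr ((p - 2) / 2) * (u t)\<^sup>2)"
      using le by (intro AE_I2) fastforce
  qed
  show "(LBINT t:A. \<bar>u t\<bar> powr p) \<le> B powr ((p - 2) / 2) * (LBINT t:A. (u t)\<^sup>2)"
    using set_integral_mono[OF J I le] by simp
qed

text \<open>Average \<open>(u x)^2 \<le> 2 (u y)^2 + 2 (u y - u x)^2\<close> over \<open>y\<close>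
  in \<open>{x..x + h}\<close> and bound the difference by Cauchy--Schwarz. Optimizing
  \<open>h\<close> would give the Gagliardo--Nirenberg inequality for the supremum; \<open>h\<close>
  stays free so that it can be adapted to the length scale.\<close>

lemma halfline_sup_bound:
  assumes W: "weak_deriv_halfline u g" and "0 \<le> x" "0 < h"
  shows "(u x)\<^sup>2 \<le> 2 / h * (LBINT t:{0..}. (u t)\<^sup>2) + 2 * h * (LBINT t:{0..}. (g t)\<^sup>2)"
proof -
  let ?M = "LBINT t:{0..}. (u t)\<^sup>2" and ?T = "LBINT t:{0..}. (g t)\<^sup>2"
  note Iu = weak_deriv_halflineD(3)[OF W]
  have mono: "(LBINT t:{x..x + h}. (u t)\<^sup>2) \<le> ?M" "(LBINT t:{x..x + h}. (g t)\<^sup>2) \<le> ?T"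
    using assms by (intro interval_mono weak_deriv_halflineD(2,3)[OF W]; auto)+
  have I: "set_integrable lborel {x..x + h} (\<lambda>t. 2 * (u t)\<^sup>2)"
    using set_integrable_subset[OF Iu, of "{x..x + h}"] assms by auto
  have "h * (u x)\<^sup>2 = (LBINT t:{x..x + h}. (u x)\<^sup>2)" using assms by (simp add: set_integral_const_interval)
  also have "\<dots> \<le> (LBINT t:{x..x + h}. 2 * (u t)\<^sup>2 + 2 * (h * ?T))"
  proof (rule set_integral_mono)
    fix y assume y: "y \<in> {x..x + h}"
    have "(u y - u x)\<^sup>2 \<le> h * (LBINT t:{x..x + h}. (g t)\<^sup>2)"
      by (rule weak_deriv_osc_le[OF weak_deriv_halflineD(1)[OF W]]) (use y assms in auto)
    also have "\<dots> \<le> h * ?T" using mono assms by simp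
    finally have "(u y - u x)\<^sup>2 \<le> h * ?T" .
    moreover have "(u x)\<^sup>2 \<le> 2 * (u y)\<^sup>2 + 2 * (u y - u x)\<^sup>2"
      using zero_le_power2[of "2 * u y - u x"] by (simp add: power2_eq_square algebra_simps)
    ultimately show "(u x)\<^sup>2 \<le> 2 * (u y)\<^sup>2 + 2 * (h * ?T)" by linarith
  qed (use I set_integrable_const_interval in auto)
  also have "\<dots> = 2 * (LBINT t:{x..x + h}. (u t)\<^sup>2) + 2 * (h * ?T) * h"
    using assms by (subst set_integral_add(2)[OF I set_integrable_const_interval])
      (simp add: set_integral_const_interval)
  also have "\<dots> \<le> 2 * ?M + 2 * (h * ?T) * h" using mono by simp
  finally show ?thesis using assms by (simp add: field_simps)
qed

section \<open>Minimal energy on the halfline\<close>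

definition halfline_energy :: "real \<Rightarrow> (real \<Rightarrow> real) \<Rightarrow> (real \<Rightarrow> real) \<Rightarrow> real" where
  "halfline_energy p u g =
     1/2 * (LBINT t:{0..}. (g t)\<^sup>2) - 1/p * (LBINT t:{0..}. \<bar>u t\<bar> powr p)"

lemma weak_deriv_halfline_zero: "weak_deriv_halfline (\<lambda>_. 0) (\<lambda>_. 0)"
  by (simp add: weak_deriv_halfline_def weak_deriv_interval_def set_integrable_def)

text \<open>The test function is a tent of half-width \<open>k / \<Lambda>\<close>; the slow decay of its nonlinear term
  as \<open>k\<close> grows, due to \<open>q < 2\<close>, makes the energy negative.\<close>

lemma negative_energy_test_function:
  fixes p :: real
  assumes "2 < p" "p < 6"
  shows "\<exists>\<theta>>0. \<forall>\<mu> \<Lambda>. 0 < \<mu> \<and> 0 < \<Lambda> \<and> (\<mu> * \<Lambda>) powr ((p - 2) / 2) = \<Lambda>\<^sup>2 \<longrightarrow>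
    (\<exists>v g. weak_deriv_halfline v g \<and> v 0 = 0 \<and> (LBINT t:{0..}. (v t)\<^sup>2) = \<mu> \<and>
           halfline_energy p v g \<le> - \<theta> * \<mu> * \<Lambda>\<^sup>2)"
proof -
  define q where "q = (p - 2) / 2"
  have q: "0 < q" "q < 2" using assms by (auto simp: q_def)
  \<comment> \<open>This makes \<open>k powr (2 - q)\<close> exceed \<open>3 * p * 4 powr q\<close>,
    which is exactly positivity of \<open>\<theta>\<close>: the nonlinear gain
    \<open>(4 * k) powr (- q) / (2 * p)\<close> beats the kinetic cost
    \<open>3 / (2 * k\<^sup>2)\<close>.\<close>
  define k where "k = (3 * p * 4 powr q + 1) powr (1 / (2 - q))"
  have kb: "0 < 3 * p * 4 powr q + 1" using assms by (intro add_nonneg_pos) auto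
  then have k: "k > 0" by (simp add: k_def)
  have "k powr (2 - q) = 3 * p * 4 powr q + 1"
    unfolding k_def using q kb by (simp add: powr_powr)
  then have k_big: "3 * p * 4 powr q < k powr 2 / k powr q"
    by (simp add: powr_diff)
  define \<theta> where "\<theta> = (4 * k) powr (- q) / (2 * p) - 3 / (2 * k\<^sup>2)"
  have "3 / (2 * k\<^sup>2) < (4 * k) powr (- q) / (2 * p)"
    using k_big k assms by (simp add: powr_minus powr_mult field_simps)
  then have th: "\<theta> > 0" by (simp add: \<theta>_def)
  show ?thesis
  proof (intro exI[of _ \<theta>] conjI allI impI th)
    fix \<mu> \<Lambda> :: real assume "0 < \<mu> \<and> 0 < \<Lambda> \<and> (\<mu> * \<Lambda>) powr ((p - 2) / 2) = \<Lambda>\<^sup>2"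
    then have pos: "0 < \<mu>" "0 < \<Lambda>" and scal: "(\<mu> * \<Lambda>) powr q = \<Lambda>\<^sup>2" by (auto simp: q_def)
    define l where "l = k / \<Lambda>"
    have l: "l > 0" using k pos by (simp add: l_def)
    \<comment> \<open>The height \<open>c\<close> normalizes the mass
      \<open>2 * c\<^sup>2 * l / 3\<close> of the tent to \<open>\<mu>\<close>. The tent is built
      backwards: first the descending half \<open>w\<close>, then the ascending half in front of
      it.\<close>
    define c where "c = sqrt (3 * \<mu> / (2 * l))"
    have c2: "c\<^sup>2 = 3 * \<mu> / (2 * l)" using pos l by (simp add: c_def)
    define w gw where "w = prepend l (\<lambda>t. c + (- c / l) * t) (\<lambda>_. 0)"
      and "gw = prepend l (\<lambda>_. - c / l) (\<lambda>_. 0)"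
    define v g where "v = prepend l (\<lambda>t. 0 + (c / l) * t) w" and "g = prepend l (\<lambda>_. c / l) gw"
    have Ww: "weak_deriv_halfline w gw"
      unfolding w_def gw_def using l
      by (intro weak_deriv_prepend weak_deriv_linear weak_deriv_halfline_zero) auto
    have w0: "w 0 = c" using l by (simp add: w_def prepend_def)
    have Wv: "weak_deriv_halfline v g"
      unfolding v_def g_def using l w0
      by (intro weak_deriv_prepend weak_deriv_linear Ww) auto
    have v0: "v 0 = 0" using l by (simp add: v_def prepend_def)
    have lin: "set_integrable lborel {0..l} (\<lambda>t. (a + b * t)\<^sup>2)" for a b :: real
      by (intro borel_integrable_atLeastAtMost' continuous_intros)
    have zero: "set_integrable lborel {0::real..} (\<lambda>_. (0::real)\<^sup>2)" by (simp add: set_integrable_def)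
    have "(LBINT t:{0..}. (w t)\<^sup>2) = (LBINT t:{0..l}. (c + (- c / l) * t)\<^sup>2) + (LBINT t:{0::real..}. 0\<^sup>2)"
      unfolding w_def by (intro integral_prepend(2)[where F = "\<lambda>x. x\<^sup>2"] less_imp_le l lin zero)
    also have "\<dots> = c\<^sup>2 * l / 3"
      using l by (subst integral_linear_square) (auto simp: field_simps power2_eq_square power3_eq_cube)
    finally have Mw: "(LBINT t:{0..}. (w t)\<^sup>2) = c\<^sup>2 * l / 3" .
    have "(LBINT t:{0..}. (v t)\<^sup>2) = (LBINT t:{0..l}. (0 + (c / l) * t)\<^sup>2) + (LBINT t:{0..}. (w t)\<^sup>2)"
      unfolding v_def
      by (intro integral_prepend(2)[where F = "\<lambda>x. x\<^sup>2"] less_imp_le l lin weak_deriv_halflineD(3)[OF Ww])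
    also have "\<dots> = 2 * (c\<^sup>2 * l / 3)"
      unfolding Mw using l
      by (subst integral_linear_square) (auto simp: field_simps power2_eq_square power3_eq_cube)
    also have "\<dots> = \<mu>" using l by (simp add: c2)
    finally have Mv: "(LBINT t:{0..}. (v t)\<^sup>2) = \<mu>" .
    have "(LBINT t:{0..}. (gw t)\<^sup>2) = (LBINT t:{0..l}. (- c / l)\<^sup>2) + (LBINT t:{0::real..}. 0\<^sup>2)"
      unfolding gw_def
      by (intro integral_prepend(2)[where F = "\<lambda>x. x\<^sup>2"] less_imp_le l set_integrable_const_interval zero)
    then have Kw: "(LBINT t:{0..}. (gw t)\<^sup>2) = c\<^sup>2 / l"
      using l by (simp add: set_integral_const_interval power2_eq_square)
    have "(LBINT t:{0..}. (g t)\<^sup>2) = (LBINT t:{0..l}. (c / l)\<^sup>2) + (LBINT t:{0..}. (gw t)\<^sup>2)"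
      unfolding g_def using l set_integrable_const_interval weak_deriv_halflineD(2)[OF Ww]
      by (intro integral_prepend(2)[where F = "\<lambda>x. x\<^sup>2"]) auto
    also have "\<dots> = 2 * (c\<^sup>2 / l)"
      unfolding Kw using l by (simp add: set_integral_const_interval power2_eq_square)
    also have "\<dots> = 3 * \<mu> * \<Lambda>\<^sup>2 / k\<^sup>2"
      unfolding c2 using l pos k by (simp add: l_def field_simps power2_eq_square)
    finally have Kv: "(LBINT t:{0..}. (g t)\<^sup>2) = 3 * \<mu> * \<Lambda>\<^sup>2 / k\<^sup>2" .
    \<comment> \<open>\<open>\<kappa>\<close> is half the mean of \<open>v^2\<close> over the
      support \<open>{0..2 * l}\<close>. Integrating \<open>\<bar>v\<bar> powr p \<ge> \<kappa> powr
      q * (v^2 - \<kappa>)\<close> retains half the mass and avoids computing the integral of the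
      power.\<close>
    define \<kappa> where "\<kappa> = \<mu> / (4 * l)"
    have kappa: "\<kappa> powr q = (4 * k) powr (- q) * \<Lambda>\<^sup>2"
    proof -
      have "\<kappa> = (\<mu> * \<Lambda>) / (4 * k)" using pos k by (simp add: \<kappa>_def l_def)
      then have "\<kappa> powr q = (\<mu> * \<Lambda>) powr q / (4 * k) powr q"
        using pos k by (simp only: powr_divide)
      then show ?thesis unfolding scal powr_minus by (simp add: divide_inverse mult.commute)
    qed
    have Iv: "set_integrable lborel {0..} (\<lambda>t. (v t)\<^sup>2)" by (rule weak_deriv_halflineD(3)[OF Wv])
    have tail: "v (t + 2 * l) = 0" if "0 \<le> t" for t
      using that l by (simp add: v_def w_def prepend_def)
    have "(LBINT t:{0..}. (v (t + 2 * l))\<^sup>2) = (LBINT t:{0::real..}. 0)"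
      by (rule set_lebesgue_integral_cong) (use tail in auto)
    then have Mv2: "(LBINT t:{0..2 * l}. (v t)\<^sup>2) = \<mu>"
      using halfline_split(2)[OF _ Iv, of "2 * l"] l Mv by simp
    have Iv2: "set_integrable lborel {0..2 * l} (\<lambda>t. (v t)\<^sup>2)"
      using set_integrable_subset[OF Iv, of "{0..2 * l}"] by auto
    have bnd: "(v t)\<^sup>2 \<le> 2 * \<mu> + 2 * (3 * \<mu> * \<Lambda>\<^sup>2 / k\<^sup>2)" if "t \<in> {0..}" for t
      using halfline_sup_bound[OF Wv, of t 1] that by (simp add: Mv Kv)
    have Ip: "set_integrable lborel {0..} (\<lambda>t. \<bar>v t\<bar> powr p)"
      by (rule powr_integral_bound(1)[OF assms(1) _ Iv bnd]) auto
    have "\<kappa> powr q * (\<mu> / 2) = \<kappa> powr q * (LBINT t:{0..2 * l}. (v t)\<^sup>2 - \<kappa>)"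
      using l Iv2 set_integrable_const_interval by (simp add: Mv2 set_integral_const_interval \<kappa>_def)
    also have "\<dots> = (LBINT t:{0..2 * l}. \<kappa> powr q * ((v t)\<^sup>2 - \<kappa>))" by simp
    also have "\<dots> \<le> (LBINT t:{0..2 * l}. \<bar>v t\<bar> powr p)"
    proof (rule set_integral_mono)
      show "set_integrable lborel {0..2 * l} (\<lambda>t. \<bar>v t\<bar> powr p)"
        using set_integrable_subset[OF Ip, of "{0..2 * l}"] by auto
      fix t
      have "0 \<le> \<kappa>" using pos l by (simp add: \<kappa>_def)
      show "\<kappa> powr q * ((v t)\<^sup>2 - \<kappa>) \<le> \<bar>v t\<bar> powr p"
      proof (cases "(v t)\<^sup>2 \<le> \<kappa>")
        case True
        then have "\<kappa> powr q * ((v t)\<^sup>2 - \<kappa>) \<le> 0" by (simp add: mult_nonneg_nonpos)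
        then show ?thesis using powr_ge_zero order_trans by blast
      next
        case False
        have "\<kappa> powr q * ((v t)\<^sup>2 - \<kappa>) \<le> \<kappa> powr q * (v t)\<^sup>2"
          using \<open>0 \<le> \<kappa>\<close> by (intro mult_left_mono) auto
        also have "\<dots> \<le> ((v t)\<^sup>2) powr q * (v t)\<^sup>2"
          using False \<open>0 \<le> \<kappa>\<close> q by (intro mult_right_mono powr_mono2) auto
        finally show ?thesis using powr_eq_square_powr[OF assms(1), of "v t"] by (simp add: q_def)
      qed
    qed (use Iv2 set_integrable_const_interval in auto)
    also have "\<dots> \<le> (LBINT t:{0..}. \<bar>v t\<bar> powr p)"
      by (rule interval_mono[OF Ip]) auto
    finally have "1/p * (\<kappa> powr q * (\<mu> / 2)) \<le> 1/p * (LBINT t:{0..}. \<bar>v t\<bar> powr p)"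
      using assms by (intro mult_left_mono) auto
    then have "halfline_energy p v g \<le> 1/2 * (3 * \<mu> * \<Lambda>\<^sup>2 / k\<^sup>2) - 1/p * (\<kappa> powr q * (\<mu> / 2))"
      unfolding halfline_energy_def Kv by linarith
    also have "\<dots> = - \<theta> * \<mu> * \<Lambda>\<^sup>2"
      unfolding kappa \<theta>_def using k assms by (simp add: field_simps)
    finally show "\<exists>v g. weak_deriv_halfline v g \<and> v 0 = 0 \<and> (LBINT t:{0..}. (v t)\<^sup>2) = \<mu> \<and>
           halfline_energy p v g \<le> - \<theta> * \<mu> * \<Lambda>\<^sup>2"
      using Wv v0 Mv by blast
  qed
qed

text \<open>\<open>E\<close> plays the role of the ground state energy and \<open>\<Lambda> = \<mu>\<^sup>\<beta>\<close>; \<open>\<Lambda>\<inverse>\<close> is the natural length scale.\<close>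

locale minimal_level =
  fixes p \<mu> \<Lambda> E \<theta> C :: real
  assumes p: "2 < p" "p < 6" and mu: "0 < \<mu>" and lam: "0 < \<Lambda>"
    and scaling: "(\<mu> * \<Lambda>) powr ((p - 2) / 2) = \<Lambda>\<^sup>2"
    and theta: "0 < \<theta>" and E_upper: "E \<le> - \<theta> * \<mu> * \<Lambda>\<^sup>2"
    and C: "1 \<le> C" and E_lower: "- C * \<mu> * \<Lambda>\<^sup>2 \<le> E"
    and minimal: "\<And>v g. weak_deriv_halfline v g \<Longrightarrow> v 0 = 0 \<Longrightarrow> (LBINT t:{0..}. (v t)\<^sup>2) = \<mu> \<Longrightarrow>
                   E \<le> halfline_energy p v g"

text \<open>The three summands pay for the mass added by the ramp in
  \<open>tail_energy_bound\<close>, for the change of the nonlinear term under rescaling, and for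
  the kinetic energy of the ramp.\<close>

definition tail_const :: "real \<Rightarrow> real \<Rightarrow> real" where
  "tail_const p C = C / 3 + (p - 2) / 2 / (3 * p) * C powr ((p - 2) / 2) * (1 + C / 3) + 1 / 2"

lemma tail_const_pos: "2 < p \<Longrightarrow> 0 \<le> C \<Longrightarrow> 0 < tail_const p C"
  unfolding tail_const_def by (intro add_nonneg_pos add_nonneg_nonneg mult_nonneg_nonneg) auto

text \<open>These are the absorption conditions of \<open>head_vanishes\<close>: the boundary term
  must cost at most a quarter of \<open>D\<close> and of
  \<open>\<theta> * \<Lambda>\<^sup>2 * m\<close>, and the nonlinear term another quarter of the
  latter.\<close>

definition small :: "real \<Rightarrow> real \<Rightarrow> real \<Rightarrow> real \<Rightarrow> bool" where
  "small p \<theta> C \<eta> \<longleftrightarrow> 0 < \<eta> \<and> tail_const p C * \<eta> \<le> 1 / 4 \<and> tail_const p C * \<eta> \<le> \<theta> / 4 \<and>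
     \<eta> powr ((p - 2) / 2) / p \<le> \<theta> / 4"

lemma exists_small:
  assumes "2 < p" "0 < \<theta>" "0 \<le> C"
  shows "\<exists>\<eta>. small p \<theta> C \<eta>"
proof -
  define K where "K = tail_const p C"
  have K: "0 < K" using tail_const_pos assms by (simp add: K_def)
  define q where "q = (p - 2) / 2"
  define \<eta> where "\<eta> = min (min (1 / (4 * K)) (\<theta> / (4 * K))) ((p * \<theta> / 4) powr (1 / q))"
  have "0 < \<eta>" using K assms by (simp add: \<eta>_def)
  moreover have "K * \<eta> \<le> K * (1 / (4 * K))" "K * \<eta> \<le> K * (\<theta> / (4 * K))"
    using K by (intro mult_left_mono; simp add: \<eta>_def)+
  moreover have "\<eta> powr q \<le> ((p * \<theta> / 4) powr (1 / q)) powr q"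
    using \<open>0 < \<eta>\<close> assms by (intro powr_mono2) (auto simp: \<eta>_def q_def)
  ultimately show ?thesis
    unfolding small_def K_def[symmetric] q_def[symmetric] using K assms
    by (intro exI[of _ \<eta>]) (simp add: powr_powr q_def field_simps)
qed

context minimal_level begin

lemma scaled_powr: "0 \<le> \<eta> \<Longrightarrow> (\<eta> * \<mu> * \<Lambda>) powr ((p - 2) / 2) = \<eta> powr ((p - 2) / 2) * \<Lambda>\<^sup>2"
  using mu lam scaling by (simp add: powr_mult mult.assoc)

text \<open>Prepending a linear ramp of length \<open>\<Lambda>\<inverse>\<close> makes the function vanish at 0, and rescaling its
  amplitude makes it a competitor in the minimality of \<open>E\<close>.\<close>

lemma tail_energy_bound:
  assumes W: "weak_deriv_halfline u g" and mass: "(LBINT t:{0..}. (u t)\<^sup>2) = \<mu> - m" and "0 \<le> m"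
    and sup: "\<And>t. 0 \<le> t \<Longrightarrow> (u t)\<^sup>2 \<le> C * \<mu> * \<Lambda>"
  shows "E + \<theta> * \<Lambda>\<^sup>2 * m - tail_const p C * \<Lambda> * (u 0)\<^sup>2 \<le> halfline_energy p u g"
proof -
  define q where "q = (p - 2) / 2"
  have q: "0 < q" using p by (simp add: q_def)
  define a where "a = u 0"
  define s where "s = 1 / \<Lambda>"
  have s: "s > 0" using lam by (simp add: s_def)
  define v gv where "v = prepend s (\<lambda>t. 0 + (a * \<Lambda>) * t) u" and "gv = prepend s (\<lambda>_. a * \<Lambda>) g"
  have Wv: "weak_deriv_halfline v gv"
    unfolding v_def gv_def using s lam
    by (intro weak_deriv_prepend weak_deriv_linear W) (auto simp: a_def s_def)
  have v0: "v 0 = 0" using s by (simp add: v_def prepend_def)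
  have Iv: "set_integrable lborel {0..} (\<lambda>t. (v t)\<^sup>2)" by (rule weak_deriv_halflineD(3)[OF Wv])
  have lin: "set_integrable lborel {0..s} (\<lambda>t. (0 + (a * \<Lambda>) * t)\<^sup>2)"
    by (intro borel_integrable_atLeastAtMost' continuous_intros)
  define M where "M = (LBINT t:{0..}. (v t)\<^sup>2)"
  define T where "T = (LBINT t:{0..}. (gv t)\<^sup>2)"
  define P where "P = (LBINT t:{0..}. \<bar>v t\<bar> powr p)"
  \<comment> \<open>The ramp adds mass \<open>a\<^sup>2 / (3 * \<Lambda>)\<close>, which is
    \<open>z * \<mu>\<close>; thus \<open>z\<close> is its share of \<open>\<mu>\<close>.\<close>
  define z where "z = a\<^sup>2 / (3 * \<Lambda> * \<mu>)"
  have z: "0 \<le> z" using lam mu by (simp add: z_def)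
  have a2: "a\<^sup>2 \<le> C * \<mu> * \<Lambda>" using sup[of 0] by (simp add: a_def)
  have m_le: "m \<le> \<mu>" using set_integral_nonneg_real[of "{0..}" "\<lambda>t. (u t)\<^sup>2"] mass by simp
  have "M = (LBINT t:{0..s}. (0 + (a * \<Lambda>) * t)\<^sup>2) + (LBINT t:{0..}. (u t)\<^sup>2)"
    unfolding M_def v_def using s lin weak_deriv_halflineD(3)[OF W]
    by (intro integral_prepend(2)[where F = "\<lambda>x. x\<^sup>2"]) auto
  also have "(LBINT t:{0..s}. (0 + (a * \<Lambda>) * t)\<^sup>2) = z * \<mu>"
    using s lam mu by (subst integral_linear_square) (auto simp: z_def s_def field_simps power2_eq_square power3_eq_cube)
  finally have M: "M = \<mu> - m + z * \<mu>" using mass by simp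
  have "T = (LBINT t:{0..s}. (a * \<Lambda>)\<^sup>2) + (LBINT t:{0..}. (g t)\<^sup>2)"
    unfolding T_def gv_def using s set_integrable_const_interval weak_deriv_halflineD(2)[OF W]
    by (intro integral_prepend(2)[where F = "\<lambda>x. x\<^sup>2"]) auto
  then have T: "T = a\<^sup>2 * \<Lambda> + (LBINT t:{0..}. (g t)\<^sup>2)"
    using s lam by (simp add: set_integral_const_interval s_def power2_eq_square)
  have Ip: "set_integrable lborel {0..} (\<lambda>t. \<bar>u t\<bar> powr p)"
    using powr_integral_bound(1)[OF p(1) _ weak_deriv_halflineD(3)[OF W], of "C * \<mu> * \<Lambda>"] sup by simp
  have Ipl: "set_integrable lborel {0..s} (\<lambda>t. \<bar>0 + (a * \<Lambda>) * t\<bar> powr p)"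
    using p by (intro borel_integrable_atLeastAtMost' continuous_on_powr' continuous_intros) auto
  have "P = (LBINT t:{0..s}. \<bar>0 + (a * \<Lambda>) * t\<bar> powr p) + (LBINT t:{0..}. \<bar>u t\<bar> powr p)"
    unfolding P_def v_def using s Ip Ipl
    by (intro integral_prepend(2)[where F = "\<lambda>x. \<bar>x\<bar> powr p"]) auto
  moreover have "0 \<le> (LBINT t:{0..s}. \<bar>0 + (a * \<Lambda>) * t\<bar> powr p)"
    by (rule set_integral_nonneg_real) simp
  ultimately have P_ge: "(LBINT t:{0..}. \<bar>u t\<bar> powr p) \<le> P" by simp
  have v_sup: "(v t)\<^sup>2 \<le> C * \<mu> * \<Lambda>" if "t \<in> {0..}" for t
  proof (cases "t < s")
    case True
    then have "0 \<le> \<Lambda> * t" "\<Lambda> * t \<le> 1" using that lam by (auto simp: s_def field_simps)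
    then have "(\<Lambda> * t)\<^sup>2 \<le> 1" by (simp add: power_le_one)
    then have "a\<^sup>2 * (\<Lambda> * t)\<^sup>2 \<le> a\<^sup>2 * 1" by (intro mult_left_mono) auto
    then show ?thesis using True a2 by (simp add: v_def prepend_def power_mult_distrib mult.assoc)
  next
    case False then show ?thesis using sup[of "t - s"] by (simp add: v_def prepend_def)
  qed
  have "P \<le> (C * \<mu> * \<Lambda>) powr q * M"
    unfolding P_def M_def q_def using p by (intro powr_integral_bound(2) v_sup Iv) auto
  then have P_le: "P \<le> C powr q * \<Lambda>\<^sup>2 * M" using scaled_powr[of C] C by (simp add: q_def)
  have P0: "0 \<le> P" unfolding P_def by (rule set_integral_nonneg_real) simp
  have M0: "0 \<le> M" unfolding M_def by (rule set_integral_nonneg_real) simp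
  define r where "r = M / \<mu>"
  have r: "r = 1 - m / \<mu> + z" using mu by (simp add: r_def M field_simps)
  have "z \<le> C / 3"
  proof -
    have "z \<le> C * \<mu> * \<Lambda> / (3 * \<Lambda> * \<mu>)" unfolding z_def using a2 lam mu by (intro divide_right_mono) auto
    also have "\<dots> = C / 3" using lam mu by simp
    finally show ?thesis .
  qed
  then have r_le: "r \<le> 1 + C / 3" using r \<open>0 \<le> m\<close> mu by (smt (verit) divide_nonneg_pos)
  \<comment> \<open>Dividing \<open>v\<close> by the square root of \<open>r\<close> restores mass
    \<open>\<mu>\<close>. The kinetic term is then divided by \<open>r\<close>, the nonlinear term
    by \<open>r powr (q + 1)\<close>. After multiplication of the inequality by \<open>r\<close>,
    only the factor \<open>(1 / r) powr q\<close> remains to be compared with 1. If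
    \<open>M = 0\<close>, no rescaling is possible, but then \<open>P = 0\<close>.\<close>
  have "r * E - q * z * P / p \<le> 1/2 * T - 1/p * P"
  proof (cases "M = 0")
    case True
    then have "P = 0" using P_le P0 by simp
    moreover have "0 \<le> T" unfolding T_def by (rule set_integral_nonneg_real) simp
    ultimately show ?thesis using True by (simp add: r_def)
  next
    case False
    then have Mpos: "0 < M" and rpos: "0 < r" using M0 mu by (auto simp: r_def)
    define c where "c = sqrt (1 / r)"
    have c: "c > 0" "c\<^sup>2 = 1 / r" using rpos by (auto simp: c_def)
    have cp: "c powr p = (1 / r) powr q * (1 / r)"
      using powr_eq_square_powr[OF p(1), of c] c by (simp add: q_def)
    have "(LBINT t:{0..}. (c * v t)\<^sup>2) = \<mu>"
      using Mpos mu by (simp add: power_mult_distrib c M_def[symmetric] r_def)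
    with weak_deriv_halfline_scale[OF Wv, of c] v0
    have "E \<le> halfline_energy p (\<lambda>t. c * v t) (\<lambda>t. c * gv t)" by (intro minimal) auto
    also have "\<dots> = 1/2 * (1 / r * T) - 1/p * ((1 / r) powr q * (1 / r) * P)"
      unfolding halfline_energy_def using c(1)
      by (simp add: power_mult_distrib c(2) abs_mult powr_mult cp T_def P_def)
    finally have "r * E \<le> r * (1/2 * (1 / r * T) - 1/p * ((1 / r) powr q * (1 / r) * P))"
      using rpos by (intro mult_left_mono) auto
    also have "\<dots> = 1/2 * T - (1 / r) powr q * (P / p)"
      using rpos by (simp add: field_simps)
    finally have 1: "r * E \<le> 1/2 * T - (1 / r) powr q * (P / p)" .
    have "1 - q * z \<le> (1 / r) powr q"
    \<comment> \<open>Combine \<open>ln r \<le> r - 1 \<le> z\<close> with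
      \<open>exp x \<ge> 1 + x\<close>.\<close>
    proof -
      have "ln r \<le> z" using ln_le_minus_one[OF rpos] r \<open>0 \<le> m\<close> mu by (smt (verit) divide_nonneg_pos)
      then have "1 - q * z \<le> 1 + (- q * ln r)" using q by simp
      also have "\<dots> \<le> exp (- q * ln r)" by (rule exp_ge_add_one_self)
      also have "\<dots> = (1 / r) powr q" using rpos by (simp add: powr_def ln_div)
      finally show ?thesis .
    qed
    then have "(1 - q * z) * (P / p) \<le> (1 / r) powr q * (P / p)"
      using P0 p by (intro mult_right_mono) auto
    moreover have "(1 - q * z) * (P / p) = 1/p * P - q * z * P / p" by (simp add: left_diff_distrib diff_divide_distrib)
    ultimately show ?thesis using 1 by linarith
  qed
  moreover have "q * z * P / p \<le> q / (3 * p) * C powr q * (1 + C / 3) * \<Lambda> * a\<^sup>2"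
  proof -
    have "P \<le> C powr q * \<Lambda>\<^sup>2 * (\<mu> * (1 + C / 3))"
    proof -
      have "M \<le> \<mu> * (1 + C / 3)" using r_le mu by (simp add: r_def field_simps)
      then have "C powr q * \<Lambda>\<^sup>2 * M \<le> C powr q * \<Lambda>\<^sup>2 * (\<mu> * (1 + C / 3))" by (intro mult_left_mono) auto
      with P_le show ?thesis by linarith
    qed
    then have "q * z / p * P \<le> q * z / p * (C powr q * \<Lambda>\<^sup>2 * (\<mu> * (1 + C / 3)))"
      using q z p by (intro mult_left_mono) auto
    also have "\<dots> = q / (3 * p) * C powr q * (1 + C / 3) * \<Lambda> * a\<^sup>2"
      using lam mu p by (simp add: z_def field_simps power2_eq_square)
    finally show ?thesis by simp
  qed
  \<comment> \<open>In \<open>r * E = E - m / \<mu> * E + z * E\<close>, the missing mass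
    \<open>m\<close> yields a gain by the upper bound on \<open>E\<close>, while the lower bound on
    \<open>E\<close> limits the loss caused by the ramp.\<close>
  moreover have "E + \<theta> * \<Lambda>\<^sup>2 * m - C / 3 * \<Lambda> * a\<^sup>2 \<le> r * E"
  proof -
    have "m / \<mu> * E \<le> m / \<mu> * (- \<theta> * \<mu> * \<Lambda>\<^sup>2)" using E_upper \<open>0 \<le> m\<close> mu by (intro mult_left_mono) auto
    moreover have "m / \<mu> * (- \<theta> * \<mu> * \<Lambda>\<^sup>2) = - \<theta> * \<Lambda>\<^sup>2 * m" using mu by simp
    moreover have "z * (- C * \<mu> * \<Lambda>\<^sup>2) \<le> z * E" using E_lower z by (intro mult_left_mono) auto
    moreover have "z * (- C * \<mu> * \<Lambda>\<^sup>2) = - (C / 3 * \<Lambda> * a\<^sup>2)"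
      using mu lam by (simp add: z_def field_simps power2_eq_square)
    moreover have "r * E = E - m / \<mu> * E + z * E" unfolding r by (simp add: algebra_simps)
    ultimately show ?thesis by linarith
  qed
  moreover have "1/2 * T - 1/p * P \<le> halfline_energy p u g + 1/2 * \<Lambda> * a\<^sup>2"
  proof -
    have "1/p * (LBINT t:{0..}. \<bar>u t\<bar> powr p) \<le> 1/p * P" using P_ge p by (intro mult_left_mono) auto
    then show ?thesis unfolding halfline_energy_def T by (simp add: algebra_simps)
  qed
  moreover have "tail_const p C * \<Lambda> * a\<^sup>2 =
      C / 3 * \<Lambda> * a\<^sup>2 + q / (3 * p) * C powr q * (1 + C / 3) * \<Lambda> * a\<^sup>2 + 1/2 * \<Lambda> * a\<^sup>2"
    unfolding tail_const_def q_def by (simp only: distrib_right)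
  ultimately show ?thesis unfolding a_def by linarith
qed

text \<open>A head with mass \<open>m\<close>, kinetic integral \<open>D\<close> and nonlinear
  integral \<open>P\<close> precedes the tail \<open>u\<close>. Inserting
  \<open>tail_energy_bound\<close> into the splitting of \<open>E\<close> and absorbing the small
  terms leaves \<open>D / 4 + \<theta> / 2 * \<Lambda>\<^sup>2 * m \<le> 0\<close>. The head is kept
  abstract so that it can be either the compact core or an initial interval of the halfline.\<close>

lemma head_vanishes:
  assumes W: "weak_deriv_halfline u g" and mass: "(LBINT t:{0..}. (u t)\<^sup>2) = \<mu> - m" and "0 \<le> m"
    and sup: "\<And>t. 0 \<le> t \<Longrightarrow> (u t)\<^sup>2 \<le> C * \<mu> * \<Lambda>"
    and energy: "E = D / 2 - P / p + halfline_energy p u g" and "0 \<le> D"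
    and P: "P \<le> (\<eta> * \<mu> * \<Lambda>) powr ((p - 2) / 2) * m"
    and bdry: "\<Lambda> * (u 0)\<^sup>2 \<le> \<eta> * (\<Lambda>\<^sup>2 * m + D)" and "small p \<theta> C \<eta>"
  shows "D = 0 \<and> m = 0"
proof -
  define K where "K = tail_const p C"
  have K: "0 < K" using tail_const_pos[of p C] p C by (simp add: K_def)
  have eta: "0 < \<eta>" "K * \<eta> \<le> 1 / 4" "K * \<eta> \<le> \<theta> / 4" "\<eta> powr ((p - 2) / 2) / p \<le> \<theta> / 4"
    using assms(9) by (auto simp: small_def K_def)
  define X where "X = \<Lambda>\<^sup>2 * m"
  have X: "0 \<le> X" using \<open>0 \<le> m\<close> by (simp add: X_def)
  have "P / p \<le> \<eta> powr ((p - 2) / 2) / p * X"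
    using P scaled_powr[of \<eta>] eta(1) p by (simp add: X_def divide_right_mono mult.assoc)
  also have "\<dots> \<le> \<theta> / 4 * X" using eta X by (intro mult_right_mono) auto
  finally have 1: "P / p \<le> \<theta> / 4 * X" .
  have "K * (\<Lambda> * (u 0)\<^sup>2) \<le> K * (\<eta> * (X + D))" using bdry K by (simp add: X_def)
  also have "\<dots> = K * \<eta> * X + K * \<eta> * D" by (simp add: algebra_simps)
  also have "\<dots> \<le> \<theta> / 4 * X + 1 / 4 * D"
    using eta X \<open>0 \<le> D\<close> by (intro add_mono mult_right_mono) auto
  finally have 2: "K * \<Lambda> * (u 0)\<^sup>2 \<le> \<theta> / 4 * X + D / 4" by (simp add: mult.assoc)
  have "E + \<theta> * X - K * \<Lambda> * (u 0)\<^sup>2 \<le> halfline_energy p u g"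
    using tail_energy_bound[OF W mass \<open>0 \<le> m\<close> sup] by (simp add: X_def K_def mult.assoc)
  with 1 2 energy have 3: "D / 4 + \<theta> / 2 * X \<le> 0" by linarith
  have "0 \<le> \<theta> / 2 * X" using X theta by simp
  with 3 \<open>0 \<le> D\<close> have "D = 0" "\<theta> / 2 * X = 0" by linarith+
  then show ?thesis using theta lam by (simp add: X_def)
qed

text \<open>An initial interval is stripped off repeatedly. Its length \<open>s\<close> depends on
  the function only through the initial kinetic integral \<open>T\<close>, which does not grow under
  shifts, so the same \<open>s\<close> serves at every step and the whole halfline is
  exhausted.\<close>

lemma no_halfline_minimizer:
  assumes "weak_deriv_halfline u g" "(LBINT t:{0..}. (u t)\<^sup>2) = \<mu>" "u 0 = 0"
    and "\<And>t. 0 \<le> t \<Longrightarrow> (u t)\<^sup>2 \<le> C * \<mu> * \<Lambda>"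
    and "halfline_energy p u g = E" and small: "small p \<theta> C \<eta>"
  shows False
proof -
  define T where "T = (LBINT t:{0..}. (g t)\<^sup>2)"
  have T: "0 \<le> T" unfolding T_def by (rule set_integral_nonneg_real) simp
  \<comment> \<open>With \<open>u 0 = 0\<close>, the square of \<open>u\<close> on
    \<open>{0..s}\<close> is at most \<open>s * D\<close>. The first bound on \<open>s\<close> makes
    the boundary term small, the second keeps \<open>u^2\<close> below
    \<open>\<eta> * \<mu> * \<Lambda>\<close>. The \<open>+ 1\<close> covers
    \<open>T = 0\<close>.\<close>
  define s where "s = min (\<eta> / \<Lambda>) (\<eta> * \<mu> * \<Lambda> / (T + 1))"
  have eta: "0 < \<eta>" using small by (simp add: small_def)
  have s: "0 < s" "\<Lambda> * s \<le> \<eta>" "s * T \<le> \<eta> * \<mu> * \<Lambda>"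
  proof -
    show "0 < s" using eta lam mu T by (simp add: s_def)
    have "\<Lambda> * s \<le> \<Lambda> * (\<eta> / \<Lambda>)" using lam by (intro mult_left_mono) (auto simp: s_def)
    then show "\<Lambda> * s \<le> \<eta>" using lam by simp
    have "s * T \<le> s * (T + 1)" using \<open>0 < s\<close> by simp
    also have "\<dots> \<le> \<eta> * \<mu> * \<Lambda> / (T + 1) * (T + 1)" using T by (intro mult_right_mono) (auto simp: s_def)
    finally show "s * T \<le> \<eta> * \<mu> * \<Lambda>" using T by simp
  qed
  \<comment> \<open>Invariant of the iteration, preserved by a shift by \<open>s\<close>.\<close>
  define H where "H = (\<lambda>u g. weak_deriv_halfline u g \<and> (LBINT t:{0..}. (u t)\<^sup>2) = \<mu> \<and> u 0 = 0 \<and>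
    (\<forall>t\<ge>0. (u t)\<^sup>2 \<le> C * \<mu> * \<Lambda>) \<and> halfline_energy p u g = E \<and> (LBINT t:{0..}. (g t)\<^sup>2) \<le> T)"
  have step: "(\<forall>t\<in>{0..s}. u t = 0) \<and> H (\<lambda>t. u (t + s)) (\<lambda>t. g (t + s))" if "H u g" for u g
  proof -
    have W: "weak_deriv_halfline u g" and M: "(LBINT t:{0..}. (u t)\<^sup>2) = \<mu>" and u0: "u 0 = 0"
      and sup: "\<And>t. 0 \<le> t \<Longrightarrow> (u t)\<^sup>2 \<le> C * \<mu> * \<Lambda>" and En: "halfline_energy p u g = E"
      and Tg: "(LBINT t:{0..}. (g t)\<^sup>2) \<le> T"
      using that by (auto simp: H_def)
    define D where "D = (LBINT t:{0..s}. (g t)\<^sup>2)"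
    define m where "m = (LBINT t:{0..s}. (u t)\<^sup>2)"
    define P where "P = (LBINT t:{0..s}. \<bar>u t\<bar> powr p)"
    have nn: "0 \<le> D" "0 \<le> m" "0 \<le> P"
      unfolding D_def m_def P_def by (rule set_integral_nonneg_real; simp)+
    note Iu = weak_deriv_halflineD(3)[OF W] and Ig = weak_deriv_halflineD(2)[OF W]
    have Ip: "set_integrable lborel {0..} (\<lambda>t. \<bar>u t\<bar> powr p)"
      using powr_integral_bound(1)[OF p(1) _ Iu, of "C * \<mu> * \<Lambda>"] sup by simp
    have W': "weak_deriv_halfline (\<lambda>t. u (t + s)) (\<lambda>t. g (t + s))"
      using weak_deriv_halfline_shift[OF W] s by simp
    have M': "(LBINT t:{0..}. (u (t + s))\<^sup>2) = \<mu> - m"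
      using halfline_split(2)[OF _ Iu, of s] s M by (simp add: m_def)
    have K': "(LBINT t:{0..}. (g t)\<^sup>2) = D + (LBINT t:{0..}. (g (t + s))\<^sup>2)"
      using halfline_split(2)[OF _ Ig, of s] s by (simp add: D_def)
    have P': "(LBINT t:{0..}. \<bar>u t\<bar> powr p) = P + (LBINT t:{0..}. \<bar>u (t + s)\<bar> powr p)"
      using halfline_split(2)[OF _ Ip, of s] s by (simp add: P_def)
    have En': "E = D / 2 - P / p + halfline_energy p (\<lambda>t. u (t + s)) (\<lambda>t. g (t + s))"
      using En unfolding halfline_energy_def K' P' by (simp add: algebra_simps)
    have DT: "D \<le> T" using Tg interval_mono[OF Ig, of "{0..s}"] by (simp add: D_def)
    have osc: "(u t)\<^sup>2 \<le> s * D" if "t \<in> {0..s}" for t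
      using weak_deriv_osc_le[OF weak_deriv_halflineD(1)[OF W], of 0 0 t s s] that u0 by (simp add: D_def)
    have sD: "s * D \<le> \<eta> * \<mu> * \<Lambda>"
      using mult_left_mono[OF DT, of s] s by linarith
    have PP: "P \<le> (\<eta> * \<mu> * \<Lambda>) powr ((p - 2) / 2) * m"
      unfolding P_def m_def
    proof (rule powr_integral_bound(2)[OF p(1)])
      show "set_integrable lborel {0..s} (\<lambda>t. (u t)\<^sup>2)" using set_integrable_subset[OF Iu, of "{0..s}"] by auto
      show "(u t)\<^sup>2 \<le> \<eta> * \<mu> * \<Lambda>" if "t \<in> {0..s}" for t using osc[OF that] sD by simp
    qed simp
    have "\<Lambda> * (u (0 + s))\<^sup>2 \<le> \<eta> * (\<Lambda>\<^sup>2 * m + D)"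
    proof -
      have "\<Lambda> * (u s)\<^sup>2 \<le> \<Lambda> * (s * D)" using osc[of s] s lam by (intro mult_left_mono) auto
      also have "\<dots> \<le> \<eta> * D" using mult_right_mono[OF s(2) nn(1)] by (simp add: mult.assoc)
      also have "\<dots> \<le> \<eta> * (\<Lambda>\<^sup>2 * m + D)" using eta nn by (intro mult_left_mono) auto
      finally show ?thesis by simp
    qed
    then have "D = 0 \<and> m = 0"
      using head_vanishes[OF W' M' nn(2) _ En' nn(1) PP _ small] sup s by simp
    then have D0: "D = 0" "m = 0" by auto
    have "P = 0" using PP nn D0 by simp
    have z: "\<forall>t\<in>{0..s}. u t = 0" using osc D0 by simp
    moreover have "H (\<lambda>t. u (t + s)) (\<lambda>t. g (t + s))"
      unfolding H_def using W' M' D0 \<open>P = 0\<close> z s sup En' K' Tg by auto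
    ultimately show ?thesis by blast
  qed
  have "H (\<lambda>t. u (t + real n * s)) (\<lambda>t. g (t + real n * s))" for n
  proof (induction n)
    case 0 then show ?case using assms by (simp add: H_def T_def)
  next
    case (Suc n)
    then show ?case using step[OF Suc] by (simp add: algebra_simps)
  qed
  from step[OF this] have zero: "u (t + real n * s) = 0" if "t \<in> {0..s}" for t n using that by blast
  have "u t = 0" if "0 \<le> t" for t
  proof -
    define n where "n = nat \<lfloor>t / s\<rfloor>"
    have "real n \<le> t / s" "t / s < real n + 1" using that s by (auto simp: n_def)
    then have "t - real n * s \<in> {0..s}" using s by (auto simp: field_simps)
    from zero[OF this, of n] show ?thesis by simp
  qed
  then have "(LBINT t:{0..}. (u t)\<^sup>2) = (LBINT t:{0::real..}. 0)"
    by (intro set_lebesgue_integral_cong) auto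
  then show False using assms(2) mu by simp
qed

end

section \<open>Functions on compact graphs\<close>

lemma walk_append: "walk ends Ed a (x @ y) b \<longleftrightarrow> (\<exists>c. walk ends Ed a x c \<and> walk ends Ed c y b)"
  by (induction x arbitrary: a) auto

lemma walk_edges: "walk ends Ed a w b \<Longrightarrow> ed \<in> set w \<Longrightarrow> fst ed \<in> Ed"
  by (induction w arbitrary: a) (auto split: if_splits)

lemma walk_len_simps [simp]:
  "walk_len len [] = 0" "walk_len len (ed # w) = len (fst ed) + walk_len len w"
  "walk_len len (x @ y) = walk_len len x + walk_len len y"
  by (simp_all add: walk_len_def)

lemma walk_len_nonneg:
  assumes "walk ends Ed a w b" "\<forall>e\<in>Ed. 0 < len e"
  shows "0 \<le> walk_len len w"
  unfolding walk_len_def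
  using walk_edges[OF assms(1)] assms(2) by (intro sum_list_nonneg) (auto intro: less_imp_le)

text \<open>If the first edge recurs in the shortened remainder, a closed detour is cut out. With
  equal orientation the walk can start at the recurrence; with opposite orientation the recurrence
  ends at the initial vertex, so the walk can start just after it. With each edge used at most once,
  sums along the walk are dominated by sums over \<open>Ed\<close>.\<close>

lemma walk_distinct_edges:
  assumes "walk ends Ed a w b" "\<forall>e\<in>Ed. 0 < len e"
  shows "\<exists>w'. walk ends Ed a w' b \<and> distinct (map fst w') \<and> walk_len len w' \<le> walk_len len w"
  using assms(1)
proof (induction w arbitrary: a)
  case Nil then show ?case by (intro exI[of _ "[]"]) simp
next
  case (Cons ed w)
  define start stop where "start = (\<lambda>o'. if o' then fst (ends (fst ed)) else snd (ends (fst ed)))"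
    and "stop = (\<lambda>o'. if o' then snd (ends (fst ed)) else fst (ends (fst ed)))"
  have ed: "fst ed \<in> Ed" "start (snd ed) = a" and w: "walk ends Ed (stop (snd ed)) w b"
    using Cons.prems by (auto simp: start_def stop_def split: if_splits)
  from Cons.IH[OF w] obtain w' where w': "walk ends Ed (stop (snd ed)) w' b" "distinct (map fst w')"
    "walk_len len w' \<le> walk_len len w" by blast
  show ?case
  proof (cases "fst ed \<in> fst ` set w'")
    case False
    then show ?thesis using w' ed
      by (intro exI[of _ "ed # w'"]) (auto simp: start_def stop_def split: if_splits)
  next
    case True
    then obtain o' where "(fst ed, o') \<in> set w'" by force
    then obtain x z where xz: "w' = x @ (fst ed, o') # z" by (meson split_list)
    obtain c where c: "walk ends Ed (stop (snd ed)) x c" "walk ends Ed c ((fst ed, o') # z) b"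
      using w'(1) unfolding xz walk_append by blast
    have cz: "c = start o'" "walk ends Ed (stop o') z b"
      using c(2) by (auto simp: start_def stop_def split: if_splits)
    have nonneg: "0 \<le> walk_len len x" "0 < len (fst ed)"
      using walk_len_nonneg[OF c(1) assms(2)] ed assms(2) by auto
    show ?thesis
    proof (cases "o' = snd ed")
      case True
      then show ?thesis using c(2) cz ed w' nonneg
        by (intro exI[of _ "(fst ed, o') # z"]) (auto simp: xz)
    next
      case False
      then have "stop o' = a" using ed by (auto simp: start_def stop_def split: if_splits)
      then show ?thesis using cz w' nonneg by (intro exI[of _ z]) (auto simp: xz)
    qed
  qed
qed

lemma walk_telescope:
  fixes \<phi> :: "'v \<Rightarrow> real"
  assumes "walk ends Ed a w b" "\<And>e. e \<in> Ed \<Longrightarrow> \<bar>\<phi> (fst (ends e)) - \<phi> (snd (ends e))\<bar> \<le> c e"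
  shows "\<bar>\<phi> a - \<phi> b\<bar> \<le> sum_list (map (\<lambda>ed. c (fst ed)) w)"
  using assms(1)
proof (induction w arbitrary: a)
  case (Cons ed w)
  then show ?case using assms(2)[of "fst ed"] Cons.IH by (fastforce split: if_splits)
qed simp

lemma sum_list_distinct_edges:
  assumes "distinct (map fst w)"
  shows "sum_list (map (\<lambda>ed. c (fst ed)) w) = (\<Sum>e\<in>fst ` set w. c e)"
  using sum_list_distinct_conv_sum_set[OF assms, of c] by (simp add: comp_def)

section \<open>Path distance, diameter and total length\<close>

lemma vdist_nonneg:
  assumes "compact_graph V Ed ends len" "a \<in> V" "b \<in> V"
  shows "0 \<le> vdist ends Ed len a b"
  unfolding vdist_def
  using assms by (intro cInf_greatest) (auto simp: compact_graph_def intro: walk_len_nonneg)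

lemma Min_image_two_by_two:
  fixes F :: "'a \<times> 'b \<Rightarrow> 'c :: linorder"
  shows "Min (F ` ({a, b} \<times> {c, d})) = min (min (F (a, c)) (F (a, d))) (min (F (b, c)) (F (b, d)))"
proof -
  have "F ` ({a, b} \<times> {c, d}) = {F (a, c), F (a, d), F (b, c), F (b, d)}" by auto
  then show ?thesis by (simp add: min.assoc)
qed

lemma pdist_eq:
  "pdist ends Ed len (e, s) (f, t) =
     (let via = min (min (s + vdist ends Ed len (fst (ends e)) (fst (ends f)) + t)
                         (s + vdist ends Ed len (fst (ends e)) (snd (ends f)) + (len f - t)))
                    (min ((len e - s) + vdist ends Ed len (snd (ends e)) (fst (ends f)) + t)
                         ((len e - s) + vdist ends Ed len (snd (ends e)) (snd (ends f)) + (len f - t)))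
      in if e = f then min \<bar>s - t\<bar> via else via)"
  unfolding pdist_def Let_def Min_image_two_by_two by simp

lemma pdist_via:
  "pdist ends Ed len (e, s) (f, t) \<le> s + vdist ends Ed len (fst (ends e)) (fst (ends f)) + t"
  unfolding pdist_eq Let_def by (simp add: min_le_iff_disj)

lemma pdist_nonneg:
  assumes G: "compact_graph V Ed ends len" and x: "x \<in> graph_points Ed len" and y: "y \<in> graph_points Ed len"
  shows "0 \<le> pdist ends Ed len x y"
proof -
  obtain e s f t where xy: "x = (e, s)" "y = (f, t)" by (metis surj_pair)
  have V: "fst (ends e) \<in> V" "snd (ends e) \<in> V" "fst (ends f) \<in> V" "snd (ends f) \<in> V"
    and st: "0 \<le> s" "s \<le> len e" "0 \<le> t" "t \<le> len f"
    using G x y by (auto simp: xy compact_graph_def graph_points_def)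
  show ?thesis unfolding xy pdist_eq Let_def
    using st vdist_nonneg[OF G V(1,3)] vdist_nonneg[OF G V(1,4)] vdist_nonneg[OF G V(2,3)] vdist_nonneg[OF G V(2,4)]
    by (simp only: min.bounded_iff split: if_split) (smt (verit))
qed

lemma pdist_le_diam:
  assumes G: "compact_graph V Ed ends len" and x: "x \<in> graph_points Ed len" and y: "y \<in> graph_points Ed len"
  shows "pdist ends Ed len x y \<le> graph_diam Ed ends len"
  unfolding graph_diam_def
proof (rule cSup_upper)
  \<comment> \<open>A crude bound on all vertex distances; some finite bound is needed for
    \<open>Sup\<close> to be an upper bound.\<close>
  let ?B = "\<Sum>ab\<in>V \<times> V. vdist ends Ed len (fst ab) (snd ab)"
  have fin: "finite Ed" "finite (V \<times> V)" using G by (auto simp: compact_graph_def)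
  have len: "len e \<le> sum len Ed" if "e \<in> Ed" for e
    using member_le_sum[OF that, of len] G fin by (auto simp: compact_graph_def intro: less_imp_le)
  show "bdd_above {pdist ends Ed len x y |x y. x \<in> graph_points Ed len \<and> y \<in> graph_points Ed len}"
  proof (rule bdd_aboveI, safe)
    fix e s f t assume es: "(e, s) \<in> graph_points Ed len" "(f, t) \<in> graph_points Ed len"
    then have V: "(fst (ends e), fst (ends f)) \<in> V \<times> V" using G by (auto simp: compact_graph_def graph_points_def)
    have "vdist ends Ed len (fst (ends e)) (fst (ends f)) \<le> ?B"
      using member_le_sum[OF V, of "\<lambda>ab. vdist ends Ed len (fst ab) (snd ab)"] vdist_nonneg[OF G] fin by auto
    moreover have "s \<le> sum len Ed" "t \<le> sum len Ed" using es len by (fastforce simp: graph_points_def)+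
    ultimately show "pdist ends Ed len (e, s) (f, t) \<le> sum len Ed + ?B + sum len Ed"
      using pdist_via[of ends Ed len e s f t] by linarith
  qed
qed (use x y in blast)

text \<open>The strict inequality yields a walk without showing that the infimum is attained. For
  this reason later estimates use a number \<open>d\<close> strictly above the diameter.\<close>

lemma vdist_less_walk:
  assumes G: "compact_graph V Ed ends len" "a \<in> V" "b \<in> V" and "vdist ends Ed len a b < d"
  obtains w where "walk ends Ed a w b" "distinct (map fst w)" "walk_len len w < d"
proof -
  have "{walk_len len w |w. walk ends Ed a w b} \<noteq> {}" using G by (auto simp: compact_graph_def)
  from cInf_lessD[OF this] assms(4) obtain w where w: "walk ends Ed a w b" "walk_len len w < d"
    unfolding vdist_def by auto
  from walk_distinct_edges[OF w(1), of len] G(1) that w(2) show thesis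
    by (force simp: compact_graph_def)
qed

lemma graph_length_pos: "compact_graph V Ed ends len \<Longrightarrow> 0 < graph_length Ed len"
  unfolding graph_length_def compact_graph_def by (intro sum_pos) auto

lemma graph_diam_nonneg:
  assumes "compact_graph V Ed ends len"
  shows "0 \<le> graph_diam Ed ends len"
proof -
  obtain e where "e \<in> Ed" "0 < len e" using assms by (auto simp: compact_graph_def)
  then have "(e, 0) \<in> graph_points Ed len" by (auto simp: graph_points_def)
  then show ?thesis using pdist_nonneg[OF assms] pdist_le_diam[OF assms] order_trans by blast
qed

section \<open>Estimates on the compact core\<close>

locale graph_function =
  fixes V :: "'v set" and Ed :: "'e set" and ends :: "'e \<Rightarrow> 'v \<times> 'v" and len :: "'e \<Rightarrow> real"
    and u g :: "'e \<Rightarrow> real \<Rightarrow> real" and \<phi> :: "'v \<Rightarrow> real"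
  assumes graph: "compact_graph V Ed ends len"
    and deriv: "e \<in> Ed \<Longrightarrow> weak_deriv_interval 0 (len e) (u e) (g e)"
    and vertex: "e \<in> Ed \<Longrightarrow> u e 0 = \<phi> (fst (ends e))" "e \<in> Ed \<Longrightarrow> u e (len e) = \<phi> (snd (ends e))"
begin

definition edge_mass :: "'e \<Rightarrow> real" where "edge_mass e = (LBINT t:{0..len e}. (u e t)\<^sup>2)"
definition edge_kinetic :: "'e \<Rightarrow> real" where "edge_kinetic e = (LBINT t:{0..len e}. (g e t)\<^sup>2)"

lemma edge_nonneg: "0 \<le> edge_mass e" "0 \<le> edge_kinetic e"
  unfolding edge_mass_def edge_kinetic_def by (rule set_integral_nonneg_real; simp)+

lemma fin: "finite Ed" and len_pos: "e \<in> Ed \<Longrightarrow> 0 < len e"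
  and ends_V: "e \<in> Ed \<Longrightarrow> fst (ends e) \<in> V" "e \<in> Ed \<Longrightarrow> snd (ends e) \<in> V"
  using graph by (auto simp: compact_graph_def)

lemma connected: "a \<in> V \<Longrightarrow> b \<in> V \<Longrightarrow> \<exists>w. walk ends Ed a w b"
  using graph unfolding compact_graph_def by blast

lemma edge_integrable: "e \<in> Ed \<Longrightarrow> set_integrable lborel {0..len e} (\<lambda>t. (u e t)\<^sup>2)"
  by (intro borel_integrable_atLeastAtMost' continuous_intros weak_deriv_continuous[OF deriv])

lemma edge_kinetic_le: "e \<in> Ed \<Longrightarrow> edge_kinetic e \<le> sum edge_kinetic Ed"
  using member_le_sum[of e Ed edge_kinetic] edge_nonneg fin by auto

lemma edge_mass_le: "e \<in> Ed \<Longrightarrow> edge_mass e \<le> sum edge_mass Ed"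
  using member_le_sum[of e Ed edge_mass] edge_nonneg fin by auto

text \<open>\<open>weak_deriv_square_diff\<close> is summed along a walk with distinct edges. Each
  edge counts at most once, so the bound involves only total quantities and is uniform over all
  graphs.\<close>

lemma vertex_square_bound:
  assumes "a \<in> V" "b \<in> V" "0 < h"
  shows "(\<phi> b)\<^sup>2 \<le> (\<phi> a)\<^sup>2 + (2 / h * sum edge_mass Ed + h * sum edge_kinetic Ed)"
proof -
  define c where "c e = 2 / h * edge_mass e + h * edge_kinetic e" for e
  have c0: "0 \<le> c e" for e using edge_nonneg assms(3) by (simp add: c_def)
  obtain w0 where "walk ends Ed a w0 b" using connected assms by blast
  from walk_distinct_edges[OF this, of len] len_pos obtain w where
    w: "walk ends Ed a w b" "distinct (map fst w)" by blast
  have "\<bar>(\<phi> a)\<^sup>2 - (\<phi> b)\<^sup>2\<bar> \<le> sum_list (map (\<lambda>ed. c (fst ed)) w)"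
  proof (rule walk_telescope[OF w(1)])
    fix e assume e: "e \<in> Ed"
    show "\<bar>(\<phi> (fst (ends e)))\<^sup>2 - (\<phi> (snd (ends e)))\<^sup>2\<bar> \<le> c e"
      using weak_deriv_square_diff[OF deriv[OF e] _ assms(3)] len_pos[OF e] vertex[OF e]
      by (simp add: c_def edge_mass_def edge_kinetic_def abs_minus_commute)
  qed
  also have "\<dots> = (\<Sum>e\<in>fst ` set w. c e)" by (rule sum_list_distinct_edges[OF w(2)])
  also have "\<dots> \<le> sum c Ed" using walk_edges[OF w(1)] fin c0 by (intro sum_mono2) auto
  also have "\<dots> = 2 / h * sum edge_mass Ed + h * sum edge_kinetic Ed"
    unfolding c_def sum.distrib by (simp only: sum_distrib_left)
  finally show ?thesis by linarith
qed

text \<open>Go from \<open>a\<close> to the initial vertex of \<open>e\<close> and then along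
  \<open>e\<close>. Each of the two stretches costs at most the total, hence the factor 2.\<close>

lemma edge_square_bound:
  assumes e: "e \<in> Ed" and s: "0 \<le> s" "s \<le> len e" and "a \<in> V" "0 < h"
  shows "(u e s)\<^sup>2 \<le> (\<phi> a)\<^sup>2 + 2 * (2 / h * sum edge_mass Ed + h * sum edge_kinetic Ed)"
proof -
  have "\<bar>(u e s)\<^sup>2 - (u e 0)\<^sup>2\<bar> \<le> 2 / h * (LBINT t:{0..s}. (u e t)\<^sup>2) + h * (LBINT t:{0..s}. (g e t)\<^sup>2)"
    by (rule weak_deriv_square_diff[OF weak_deriv_subinterval[OF deriv[OF e]]]) (use assms in auto)
  also have "\<dots> \<le> 2 / h * edge_mass e + h * edge_kinetic e"
    unfolding edge_mass_def edge_kinetic_def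
    using assms weak_deriv_intervalD(2)[OF deriv[OF e]] edge_integrable[OF e]
    by (intro add_mono mult_left_mono interval_mono) auto
  also have "\<dots> \<le> 2 / h * sum edge_mass Ed + h * sum edge_kinetic Ed"
    using assms edge_mass_le[OF e] edge_kinetic_le[OF e] by (intro add_mono mult_left_mono) auto
  finally show ?thesis
    using vertex_square_bound[OF assms(4) ends_V(1)[OF e] assms(5)] vertex(1)[OF e] by simp
qed

text \<open>Cauchy--Schwarz is used twice: on each edge, and for the sum over the distinct edges of
  the walk, whose lengths add up to at most \<open>d\<close>.\<close>

lemma vertex_osc:
  assumes w: "walk ends Ed a w b" "distinct (map fst w)" "walk_len len w \<le> d"
  shows "\<bar>\<phi> a - \<phi> b\<bar> \<le> sqrt (d * sum edge_kinetic Ed)"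
proof -
  let ?S = "fst ` set w"
  have S: "?S \<subseteq> Ed" using walk_edges[OF w(1)] by auto
  have "\<bar>\<phi> a - \<phi> b\<bar> \<le> sum_list (map (\<lambda>ed. \<bar>sqrt (len (fst ed))\<bar> * \<bar>sqrt (edge_kinetic (fst ed))\<bar>) w)"
  proof (rule walk_telescope[OF w(1)])
    fix e assume e: "e \<in> Ed"
    have "(u e (len e) - u e 0)\<^sup>2 \<le> len e * edge_kinetic e"
      using weak_deriv_osc[OF deriv[OF e]] len_pos[OF e] by (simp add: edge_kinetic_def)
    then have "\<bar>u e (len e) - u e 0\<bar> \<le> sqrt (len e * edge_kinetic e)" by (rule real_le_rsqrt[of "\<bar>_\<bar>", simplified])
    then show "\<bar>\<phi> (fst (ends e)) - \<phi> (snd (ends e))\<bar> \<le> \<bar>sqrt (len e)\<bar> * \<bar>sqrt (edge_kinetic e)\<bar>"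
      using vertex[OF e] len_pos[OF e] edge_nonneg[of e] by (simp add: real_sqrt_mult abs_minus_commute)
  qed
  also have "\<dots> = (\<Sum>e\<in>?S. \<bar>sqrt (len e)\<bar> * \<bar>sqrt (edge_kinetic e)\<bar>)"
    by (rule sum_list_distinct_edges[OF w(2)])
  also have "\<dots> \<le> L2_set (\<lambda>e. sqrt (len e)) ?S * L2_set (\<lambda>e. sqrt (edge_kinetic e)) ?S"
    by (rule L2_set_mult_ineq)
  also have "\<dots> = sqrt (sum len ?S) * sqrt (sum edge_kinetic ?S)"
  proof -
    have "(\<Sum>e\<in>?S. (sqrt (len e))\<^sup>2) = sum len ?S" using S len_pos by (intro sum.cong) (auto intro: less_imp_le)
    moreover have "(\<Sum>e\<in>?S. (sqrt (edge_kinetic e))\<^sup>2) = sum edge_kinetic ?S"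
      using edge_nonneg by (intro sum.cong) auto
    ultimately show ?thesis by (simp add: L2_set_def)
  qed
  also have "\<dots> \<le> sqrt d * sqrt (sum edge_kinetic Ed)"
  proof (intro mult_mono real_sqrt_le_mono)
    show "sum len ?S \<le> d" using w(3) sum_list_distinct_edges[OF w(2), of len] by (simp add: walk_len_def)
    then show "0 \<le> sqrt d" using S len_pos sum_nonneg[of ?S len] by (auto intro: less_imp_le order_trans)
    show "sum edge_kinetic ?S \<le> sum edge_kinetic Ed" using S fin edge_nonneg by (intro sum_mono2) auto
    show "0 \<le> sqrt (sum edge_kinetic ?S)" using edge_nonneg by (simp add: sum_nonneg)
  qed
  finally show ?thesis by (simp add: real_sqrt_mult)
qed

lemma edge_osc:
  assumes e: "e \<in> Ed" and "0 \<le> s" "s \<le> len e" "0 \<le> t" "t \<le> len e" "\<bar>s - t\<bar> \<le> d"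
  shows "\<bar>u e s - u e t\<bar> \<le> sqrt (d * sum edge_kinetic Ed)"
proof -
  have "(u e y - u e x)\<^sup>2 \<le> d * sum edge_kinetic Ed" if "0 \<le> x" "x \<le> y" "y \<le> len e" "y - x \<le> d" for x y
  proof -
    have "(u e y - u e x)\<^sup>2 \<le> d * edge_kinetic e"
      unfolding edge_kinetic_def by (rule weak_deriv_osc_le[OF deriv[OF e]]) (use that in auto)
    also have "\<dots> \<le> d * sum edge_kinetic Ed" using edge_kinetic_le[OF e] that by (intro mult_left_mono) auto
    finally show ?thesis .
  qed
  from this[of s t] this[of t s] assms have "(u e s - u e t)\<^sup>2 \<le> d * sum edge_kinetic Ed"
    by (cases "s \<le> t") (auto simp: power2_commute)
  then show ?thesis by (rule real_le_rsqrt[of "\<bar>_\<bar>", simplified])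
qed

text \<open>A connecting path of length below \<open>d\<close> consists of part of an edge, a walk
  between vertices and part of another edge. Each of the three pieces contributes at most
  \<open>sqrt (d * sum edge_kinetic Ed)\<close>.\<close>

lemma point_osc:
  assumes x: "(e, s) \<in> graph_points Ed len" and y: "(f, t) \<in> graph_points Ed len"
    and d: "graph_diam Ed ends len < d"
  shows "\<bar>u e s - u f t\<bar> \<le> 3 * sqrt (d * sum edge_kinetic Ed)"
proof -
  let ?R = "sqrt (d * sum edge_kinetic Ed)"
  have "0 \<le> d" using d graph_diam_nonneg[OF graph] by simp
  then have R: "0 \<le> ?R" using edge_nonneg by (simp add: sum_nonneg)
  have es: "e \<in> Ed" "0 \<le> s" "s \<le> len e" and ft: "f \<in> Ed" "0 \<le> t" "t \<le> len f"
    using x y by (auto simp: graph_points_def)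
  have through: "\<bar>u e s - u f t\<bar> \<le> 3 * ?R"
    if a: "a \<in> V" "b \<in> V" "0 \<le> da" "0 \<le> db" "\<bar>u e s - \<phi> a\<bar> \<le> sqrt (da * sum edge_kinetic Ed)"
      "\<bar>u f t - \<phi> b\<bar> \<le> sqrt (db * sum edge_kinetic Ed)" "da + vdist ends Ed len a b + db < d" for a b da db
  proof -
    from a have "vdist ends Ed len a b < d" by linarith
    then obtain w where w: "walk ends Ed a w b" "distinct (map fst w)" "walk_len len w < d"
      using vdist_less_walk[OF graph a(1,2)] by blast
    then have "\<bar>\<phi> a - \<phi> b\<bar> \<le> ?R" using vertex_osc[OF w(1,2), of d] by simp
    moreover have "da \<le> d" "db \<le> d" using a vdist_nonneg[OF graph a(1,2)] by linarith+
    then have "sqrt (da * sum edge_kinetic Ed) \<le> ?R" "sqrt (db * sum edge_kinetic Ed) \<le> ?R"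
      using edge_nonneg by (auto intro!: mult_right_mono sum_nonneg)
    ultimately show ?thesis using a by linarith
  qed
  have near: "\<bar>u i r - \<phi> (fst (ends i))\<bar> \<le> sqrt (r * sum edge_kinetic Ed)"
    "\<bar>u i r - \<phi> (snd (ends i))\<bar> \<le> sqrt ((len i - r) * sum edge_kinetic Ed)"
    if "i \<in> Ed" "0 \<le> r" "r \<le> len i" for i r
    using edge_osc[of i r 0 r] edge_osc[of i r "len i" "len i - r"] that vertex[of i] by auto
  have "pdist ends Ed len (e, s) (f, t) < d" using pdist_le_diam[OF graph x y] d by simp
  then consider "e = f" "\<bar>s - t\<bar> < d"
    | "s + vdist ends Ed len (fst (ends e)) (fst (ends f)) + t < d"
    | "s + vdist ends Ed len (fst (ends e)) (snd (ends f)) + (len f - t) < d"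
    | "(len e - s) + vdist ends Ed len (snd (ends e)) (fst (ends f)) + t < d"
    | "(len e - s) + vdist ends Ed len (snd (ends e)) (snd (ends f)) + (len f - t) < d"
    unfolding pdist_eq Let_def by (auto simp: min_less_iff_disj split: if_splits)
  then show ?thesis
  proof cases
    case 1
    then show ?thesis using edge_osc[of e s t d] es ft R by auto
  next
    case 2 then show ?thesis by (intro through[OF _ _ _ _ near(1)[OF es] near(1)[OF ft]]) (use ends_V es ft in auto)
  next
    case 3 then show ?thesis by (intro through[OF _ _ _ _ near(1)[OF es] near(2)[OF ft]]) (use ends_V es ft in auto)
  next
    case 4 then show ?thesis by (intro through[OF _ _ _ _ near(2)[OF es] near(1)[OF ft]]) (use ends_V es ft in auto)
  next
    case 5 then show ?thesis by (intro through[OF _ _ _ _ near(2)[OF es] near(2)[OF ft]]) (use ends_V es ft in auto)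
  qed
qed

text \<open>The value at a point is compared with that at every other point, then averaged over the
  whole graph. The averaging produces the division by the total length, and
  \<open>18 = 2 * 3\<^sup>2\<close> comes from \<open>point_osc\<close>.\<close>

lemma point_square_bound:
  assumes x: "(f, t) \<in> graph_points Ed len" and d: "graph_diam Ed ends len < d"
  shows "(u f t)\<^sup>2 \<le> 2 * sum edge_mass Ed / graph_length Ed len + 18 * d * sum edge_kinetic Ed"
proof -
  let ?L = "graph_length Ed len" and ?D = "sum edge_kinetic Ed"
  have L: "0 < ?L" by (rule graph_length_pos[OF graph])
  have "0 \<le> d" using d graph_diam_nonneg[OF graph] by simp
  then have dD: "0 \<le> d * ?D" using edge_nonneg by (simp add: sum_nonneg)
  have pt: "(u f t)\<^sup>2 \<le> 2 * (u e s)\<^sup>2 + 18 * d * ?D" if "e \<in> Ed" "s \<in> {0..len e}" for e s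
  proof -
    have "(e, s) \<in> graph_points Ed len" using that by (auto simp: graph_points_def)
    from point_osc[OF x this d] have "(u f t - u e s)\<^sup>2 \<le> (3 * sqrt (d * ?D))\<^sup>2"
      by (intro power2_le_iff_abs_le[THEN iffD2]) (use dD in auto)
    also have "\<dots> = 9 * (d * ?D)" using dD by (simp add: power_mult_distrib)
    finally have "(u f t - u e s)\<^sup>2 \<le> 9 * (d * ?D)" .
    moreover have "(u f t)\<^sup>2 \<le> 2 * (u e s)\<^sup>2 + 2 * (u f t - u e s)\<^sup>2"
      using zero_le_power2[of "2 * u e s - u f t"] by (simp add: power2_eq_square algebra_simps)
    ultimately show ?thesis by linarith
  qed
  have edge: "(u f t)\<^sup>2 * len e \<le> 2 * edge_mass e + 18 * d * ?D * len e" if e: "e \<in> Ed" for e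
  proof -
    have I: "set_integrable lborel {0..len e} (\<lambda>s. 2 * (u e s)\<^sup>2)" using edge_integrable[OF e] by simp
    have "(LBINT s:{0..len e}. (u f t)\<^sup>2) \<le> (LBINT s:{0..len e}. 2 * (u e s)\<^sup>2 + 18 * d * ?D)"
      using I pt[OF e] set_integrable_const_interval by (intro set_integral_mono set_integral_add(1)) auto
    also have "\<dots> = 2 * edge_mass e + 18 * d * ?D * len e"
      by (subst set_integral_add(2)[OF I set_integrable_const_interval])
        (use len_pos[OF e] in \<open>simp add: set_integral_const_interval edge_mass_def\<close>)
    finally show ?thesis using len_pos[OF e] by (simp add: set_integral_const_interval)
  qed
  have "(u f t)\<^sup>2 * ?L = (\<Sum>e\<in>Ed. (u f t)\<^sup>2 * len e)" by (simp add: graph_length_def sum_distrib_left)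
  also have "\<dots> \<le> (\<Sum>e\<in>Ed. 2 * edge_mass e + 18 * d * ?D * len e)" by (intro sum_mono edge)
  also have "\<dots> = 2 * sum edge_mass Ed + 18 * d * ?D * ?L"
    by (simp add: sum.distrib graph_length_def sum_distrib_left)
  finally show ?thesis using L by (simp add: field_simps)
qed

text \<open>There are no isolated vertices: a walk from \<open>v\<close> to an endpoint of some edge
  is either empty or begins with an edge at \<open>v\<close>.\<close>

lemma vertex_is_point:
  assumes "v \<in> V"
  obtains e s where "(e, s) \<in> graph_points Ed len" "u e s = \<phi> v"
proof -
  obtain e where e: "e \<in> Ed" using graph by (auto simp: compact_graph_def)
  obtain w where w: "walk ends Ed v w (fst (ends e))"
    using connected assms ends_V(1)[OF e] by blast
  have "\<exists>i\<in>Ed. v = fst (ends i) \<or> v = snd (ends i)"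
    using w e by (cases w) (auto split: if_splits)
  then obtain i where i: "i \<in> Ed" "v = fst (ends i) \<or> v = snd (ends i)" by blast
  then have "(i, 0) \<in> graph_points Ed len \<and> u i 0 = \<phi> v \<or> (i, len i) \<in> graph_points Ed len \<and> u i (len i) = \<phi> v"
    using vertex[OF i(1)] len_pos[OF i(1)] by (auto simp: graph_points_def)
  then show thesis using that by blast
qed

end

section \<open>Nonexistence of ground states\<close>

text \<open>With \<open>T = \<tau> * \<mu> * \<Lambda>\<^sup>2\<close>, the choice
  \<open>h = 1 / (\<Lambda> * sqrt \<tau>)\<close> makes the two summands equal. The hypothesis
  becomes \<open>\<tau> \<le> 8 powr q * \<tau> powr (q / 2)\<close>, and \<open>q / 2 < 1\<close>,
  the subcritical range, bounds \<open>\<tau>\<close>.\<close>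

lemma kinetic_bound:
  fixes q \<mu> \<Lambda> T :: real
  assumes q: "0 < q" "q < 2" and pos: "0 < \<mu>" "0 < \<Lambda>" and scaling: "(\<mu> * \<Lambda>) powr q = \<Lambda>\<^sup>2"
    and bound: "\<And>h. 0 < h \<Longrightarrow> T \<le> (4 * \<mu> / h + 4 * h * T) powr q * \<mu>"
  shows "T \<le> 8 powr (q / (1 - q / 2)) * (\<mu> * \<Lambda>\<^sup>2)"
proof (cases "T \<le> \<mu> * \<Lambda>\<^sup>2")
  case True
  have "1 \<le> (8::real) powr (q / (1 - q / 2))" using q by (intro ge_one_powr_ge_zero) auto
  then have "1 * (\<mu> * \<Lambda>\<^sup>2) \<le> 8 powr (q / (1 - q / 2)) * (\<mu> * \<Lambda>\<^sup>2)" using pos by (intro mult_right_mono) auto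
  with True show ?thesis by simp
next
  case False
  define \<tau> where "\<tau> = T / (\<mu> * \<Lambda>\<^sup>2)"
  have tau: "1 < \<tau>" and T: "T = \<tau> * (\<mu> * \<Lambda>\<^sup>2)" using False pos by (auto simp: \<tau>_def)
  define \<sigma> where "\<sigma> = sqrt \<tau>"
  have sig: "0 < \<sigma>" "\<sigma> * \<sigma> = \<tau>" using tau by (auto simp: \<sigma>_def)
  define h where "h = 1 / (\<Lambda> * \<sigma>)"
  have h: "0 < h" using sig pos by (simp add: h_def)
  have "4 * \<mu> / h + 4 * h * T = (8 * \<sigma>) * (\<mu> * \<Lambda>)"
    unfolding T sig(2)[symmetric] h_def using sig(1) pos by (simp add: field_simps power2_eq_square)
  moreover have "((8 * \<sigma>) * (\<mu> * \<Lambda>)) powr q = (8 * \<sigma>) powr q * \<Lambda>\<^sup>2"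
    unfolding scaling[symmetric] by (rule powr_mult)
  ultimately have "T \<le> (8 * \<sigma>) powr q * \<Lambda>\<^sup>2 * \<mu>"
    using bound[OF h] by simp
  then have "\<tau> * (\<mu> * \<Lambda>\<^sup>2) \<le> (8 * \<sigma>) powr q * (\<mu> * \<Lambda>\<^sup>2)" unfolding T by (simp add: mult_ac)
  then have "\<tau> \<le> (8 * \<sigma>) powr q" using pos by simp
  also have "\<dots> = 8 powr q * \<tau> powr (q / 2)"
    using tau by (simp add: \<sigma>_def powr_mult powr_half_sqrt[symmetric] powr_powr)
  finally have "\<tau> powr (1 - q / 2) \<le> 8 powr q"
    using tau powr_diff[of \<tau> 1 "q / 2"] by (simp add: pos_divide_le_eq)
  then have "(\<tau> powr (1 - q / 2)) powr (1 / (1 - q / 2)) \<le> (8 powr q) powr (1 / (1 - q / 2))"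
    using q by (intro powr_mono2) auto
  then have "\<tau> \<le> 8 powr (q / (1 - q / 2))" using q tau by (simp add: powr_powr)
  then show ?thesis unfolding T using pos by (intro mult_right_mono) auto
qed

text \<open>Since \<open>1 + \<beta> = 4 / (6 - p)\<close>, both sides equal
  \<open>\<mu> powr (2 * \<beta>)\<close>. The identity says that kinetic and nonlinear energy have
  the same order at length scale \<open>\<mu> powr (- \<beta>)\<close>.\<close>

lemma critical_scaling:
  fixes p \<mu> :: real
  assumes "2 < p" "p < 6" "0 < \<mu>"
  shows "(\<mu> * \<mu> powr ((p - 2) / (6 - p))) powr ((p - 2) / 2) = (\<mu> powr ((p - 2) / (6 - p)))\<^sup>2"
proof -
  have "1 + (p - 2) / (6 - p) = 4 / (6 - p)" using assms by (simp add: field_simps)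
  then have "\<mu> * \<mu> powr ((p - 2) / (6 - p)) = \<mu> powr (4 / (6 - p))"
    using assms by (metis less_imp_le powr_mult_base)
  then have "(\<mu> * \<mu> powr ((p - 2) / (6 - p))) powr ((p - 2) / 2) = \<mu> powr (4 / (6 - p) * ((p - 2) / 2))"
    by (simp add: powr_powr)
  also have "4 / (6 - p) * ((p - 2) / 2) = (p - 2) / (6 - p) + (p - 2) / (6 - p)"
  proof -
    have "4 / r * (x / 2) = x / r + x / r" for r x :: real by (cases "r = 0") (simp_all add: field_simps)
    then show ?thesis .
  qed
  finally show ?thesis unfolding powr_add power2_eq_square .
qed

theorem theorem6p4:
  fixes p :: real
  assumes "2 < p" and "p < 6"
  shows "\<exists>\<epsilon>>0. \<forall>(V::nat set) (Ed::nat set) (ends::nat \<Rightarrow> nat \<times> nat) (len::nat \<Rightarrow> real) (v0::nat) (\<mu>::real).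
           compact_graph V Ed ends len \<and> v0 \<in> V \<and> 0 < \<mu> \<and>
           \<mu> powr ((p - 2) / (6 - p)) * graph_diam Ed ends len
             + 1 / (\<mu> powr ((p - 2) / (6 - p)) * graph_length Ed len) < \<epsilon>
           \<longrightarrow> \<not> (\<exists>w. is_ground_state p Ed ends len v0 \<mu> w)"
proof -

  \<comment> \<open>Constants depending only on \<open>p\<close>\<close>
  define q where "q = (p - 2) / 2"
  have q: "0 < q" "q < 2" using assms by (auto simp: q_def)
  obtain \<theta> where th: "0 < \<theta>" and test: "\<And>\<mu> \<Lambda>. 0 < \<mu> \<Longrightarrow> 0 < \<Lambda> \<Longrightarrow> (\<mu> * \<Lambda>) powr q = \<Lambda>\<^sup>2 \<Longrightarrow>
    (\<exists>v g. weak_deriv_halfline v g \<and> v 0 = 0 \<and> (LBINT t:{0..}. (v t)\<^sup>2) = \<mu> \<and>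
           halfline_energy p v g \<le> - \<theta> * \<mu> * \<Lambda>\<^sup>2)"
    using negative_energy_test_function[OF assms] unfolding q_def by blast
  define c1 :: real where "c1 = 8 powr (q / (1 - q / 2))"
  \<comment> \<open>\<open>B1 * \<mu> * \<Lambda>\<close> will bound the squared supremum, and
    \<open>B1 powr q\<close> the nonlinear term. \<open>C\<close> dominates both constants and also
    \<open>c1\<close>.\<close>
  define B1 where "B1 = 4 * (1 + c1)"
  define C where "C = B1 + B1 powr q"
  have c1: "0 \<le> c1" by (simp add: c1_def)
  then have C: "1 \<le> C" "B1 \<le> C" "B1 powr q \<le> C" "c1 \<le> C" by (auto simp: C_def B1_def intro: add_increasing2)
  obtain \<eta> where small: "small p \<theta> C \<eta>" using exists_small[of p \<theta> C] assms th C by auto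
  have eta: "0 < \<eta>" using small by (simp add: small_def)
  \<comment> \<open>In the pointwise bound on the core, \<open>2 * \<epsilon>\<close> pays for
    \<open>2 * m / L\<close> and \<open>18 * C * \<epsilon>\<close> for \<open>18 * d * D\<close>.
    As \<open>C \<ge> 1\<close>, also \<open>18 * \<epsilon> \<le> \<eta>\<close>.\<close>
  define \<epsilon> where "\<epsilon> = \<eta> / (18 * C + 2)"
  have eps: "0 < \<epsilon>" using eta C by (simp add: \<epsilon>_def)
  have eps_eta: "(18 * C + 2) * \<epsilon> = \<eta>" using C by (simp add: \<epsilon>_def)
  have "False"
    if G: "compact_graph V Ed ends len" and v0: "v0 \<in> V" and mu: "0 < \<mu>"
      and eps_bound: "\<mu> powr ((p - 2) / (6 - p)) * graph_diam Ed ends len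
             + 1 / (\<mu> powr ((p - 2) / (6 - p)) * graph_length Ed len) < \<epsilon>"
      and gs: "is_ground_state p Ed ends len v0 \<mu> w"
    for V Ed :: "nat set" and ends len v0 \<mu> w
  proof -
    define \<Lambda> where "\<Lambda> = \<mu> powr ((p - 2) / (6 - p))"
    have lam: "0 < \<Lambda>" using mu by (simp add: \<Lambda>_def)
    have scal: "(\<mu> * \<Lambda>) powr q = \<Lambda>\<^sup>2"
      unfolding \<Lambda>_def q_def by (rule critical_scaling[OF assms mu])
    have scal': "(x * \<mu> * \<Lambda>) powr q = x powr q * \<Lambda>\<^sup>2" if "0 \<le> x" for x
      using that mu lam scal by (simp add: powr_mult mult.assoc)
    define L where "L = graph_length Ed len"
    have L: "0 < L" unfolding L_def by (rule graph_length_pos[OF G])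
    have small_data: "\<Lambda> * graph_diam Ed ends len + 1 / (\<Lambda> * L) < \<epsilon>"
      using eps_bound by (simp add: \<Lambda>_def L_def)
    \<comment> \<open>The slack in the strict hypothesis leaves room for some \<open>d\<close>
      strictly above the diameter with
      \<open>\<Lambda> * d + 1 / (\<Lambda> * L) = \<epsilon>\<close>.\<close>
    define gap where "gap = \<epsilon> - (\<Lambda> * graph_diam Ed ends len + 1 / (\<Lambda> * L))"
    define d where "d = graph_diam Ed ends len + gap / \<Lambda>"
    have d: "graph_diam Ed ends len < d" using small_data lam by (simp add: d_def gap_def)
    have d0: "0 \<le> d" using d graph_diam_nonneg[OF G] by simp
    have dL: "\<Lambda> * d + 1 / (\<Lambda> * L) = \<epsilon>" using lam by (simp add: d_def gap_def distrib_left)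
    have "0 \<le> \<Lambda> * d" "0 \<le> 1 / (\<Lambda> * L)" using lam d0 L by auto
    with dL have d_le: "\<Lambda> * d \<le> \<epsilon>" and "1 / (\<Lambda> * L) \<le> \<epsilon>" by linarith+
    have L_le: "1 / L \<le> \<epsilon> * \<Lambda>" using \<open>1 / (\<Lambda> * L) \<le> \<epsilon>\<close> lam L by (simp add: field_simps)

    \<comment> \<open>Splitting a ground state into core and halfline\<close>
    obtain u g uh gh where w: "w = (u, g, uh, gh)" by (cases w) auto
    obtain \<phi> where H1: "\<And>e. e \<in> Ed \<Longrightarrow> weak_deriv_interval 0 (len e) (u e) (g e)"
      "weak_deriv_halfline uh gh"
      "\<And>e. e \<in> Ed \<Longrightarrow> u e 0 = \<phi> (fst (ends e)) \<and> u e (len e) = \<phi> (snd (ends e))" "uh 0 = \<phi> v0"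
      using gs unfolding is_ground_state_def in_H1_def w by auto
    interpret K: graph_function V Ed ends len u g \<phi>
      by unfold_locales (use G H1 in auto)
    define m where "m = sum K.edge_mass Ed"
    define D where "D = sum K.edge_kinetic Ed"
    define P where "P = (\<Sum>e\<in>Ed. LBINT t:{0..len e}. \<bar>u e t\<bar> powr p)"
    define mh where "mh = (LBINT t:{0..}. (uh t)\<^sup>2)"
    define Dh where "Dh = (LBINT t:{0..}. (gh t)\<^sup>2)"
    define Ph where "Ph = (LBINT t:{0..}. \<bar>uh t\<bar> powr p)"
    define E where "E = nls_energy p Ed len w"
    have nn: "0 \<le> m" "0 \<le> D" "0 \<le> mh" "0 \<le> Dh" "0 \<le> P" "0 \<le> Ph"
      unfolding m_def D_def P_def mh_def Dh_def Ph_def using K.edge_nonneg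
      by (auto intro!: sum_nonneg set_integral_nonneg_real)
    have mass: "m + mh = \<mu>"
      using gs unfolding is_ground_state_def mass_def w m_def mh_def K.edge_mass_def by simp
    have E_eq: "E = (D + Dh) / 2 - (P + Ph) / p"
      unfolding E_def nls_energy_def w D_def Dh_def P_def Ph_def K.edge_kinetic_def by simp
    have E_split: "E = D / 2 - P / p + halfline_energy p uh gh"
      unfolding E_eq halfline_energy_def Dh_def[symmetric] Ph_def[symmetric]
      by (simp add: add_divide_distrib)
    \<comment> \<open>Since \<open>v 0 = 0\<close>, extending \<open>v\<close> by zero to the core
      gives a competitor on the graph.\<close>
    have minimal: "E \<le> halfline_energy p v gv"
      if v: "weak_deriv_halfline v gv" "v 0 = 0" "(LBINT t:{0..}. (v t)\<^sup>2) = \<mu>" for v gv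
    proof -
      define w' where "w' = ((\<lambda>_ _. 0) :: nat \<Rightarrow> real \<Rightarrow> real, (\<lambda>_ _. 0) :: nat \<Rightarrow> real \<Rightarrow> real, v, gv)"
      have "weak_deriv_interval 0 (len e) (\<lambda>_. 0) (\<lambda>_. 0)" for e
        by (simp add: weak_deriv_interval_def set_integrable_def)
      then have "in_H1 Ed ends len v0 w'"
        unfolding in_H1_def w'_def using v by (auto intro!: exI[of _ "\<lambda>_. 0"])
      moreover have "mass Ed len w' = \<mu>" unfolding mass_def w'_def using v by simp
      ultimately have "E \<le> nls_energy p Ed len w'" using gs unfolding E_def is_ground_state_def by blast
      also have "\<dots> = halfline_energy p v gv"
        unfolding nls_energy_def w'_def halfline_energy_def using assms by simp
      finally show ?thesis .
    qed
    obtain v gv where "weak_deriv_halfline v gv" "v 0 = 0" "(LBINT t:{0..}. (v t)\<^sup>2) = \<mu>"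
      "halfline_energy p v gv \<le> - \<theta> * \<mu> * \<Lambda>\<^sup>2" using test[OF mu lam scal] by blast
    then have E_upper: "E \<le> - \<theta> * \<mu> * \<Lambda>\<^sup>2" using minimal by fastforce

    \<comment> \<open>A priori bounds on the kinetic energy, the supremum and
      \<open>E\<close>\<close>
    define T where "T = D + Dh"
    have mass_ge: "m \<le> \<mu>" "mh \<le> \<mu>" using mass nn by auto
    have sup_h: "(uh t)\<^sup>2 \<le> 4 * \<mu> / h + 4 * h * T" if "0 \<le> t" "0 < h" for t h
    proof -
      have "(uh t)\<^sup>2 \<le> 2 / h * mh + 2 * h * Dh"
        using halfline_sup_bound[OF H1(2) that] by (simp add: mh_def Dh_def)
      also have "\<dots> \<le> 4 / h * \<mu> + 4 * h * T"
        using that nn mass_ge by (intro add_mono mult_mono divide_right_mono) (auto simp: T_def)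
      finally show ?thesis by simp
    qed
    \<comment> \<open>The core is reached from the attaching vertex \<open>v0\<close>, where the
      halfline bound applies. The resulting mass terms fit into \<open>4 / h * (m + mh)\<close>,
      which explains the constant 4, used also in \<open>sup_h\<close>.\<close>
    have sup_K: "(u e t)\<^sup>2 \<le> 4 * \<mu> / h + 4 * h * T" if "e \<in> Ed" "0 \<le> t" "t \<le> len e" "0 < h" for e t h
    proof -
      have "(u e t)\<^sup>2 \<le> (uh 0)\<^sup>2 + 2 * (2 / h * m + h * D)"
        using K.edge_square_bound[OF that(1-3) v0 that(4)] H1(4) by (simp add: m_def D_def)
      also have "(uh 0)\<^sup>2 \<le> 2 / h * mh + 2 * h * Dh"
        using halfline_sup_bound[OF H1(2) order_refl that(4)] by (simp add: mh_def Dh_def)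
      also have "2 / h * mh + 2 * h * Dh + 2 * (2 / h * m + h * D) = 4 / h * (m + mh) - 2 / h * mh + 2 * h * T"
        by (simp add: T_def algebra_simps add_divide_distrib)
      also have "\<dots> \<le> 4 / h * \<mu> + 4 * h * T"
      proof -
        have "0 \<le> 2 / h * mh" "0 \<le> 2 * h * T" using that nn by (auto simp: T_def)
        then show ?thesis unfolding mass by linarith
      qed
      finally show ?thesis by simp
    qed
    have P_bounds: "P \<le> X powr q * m" if "\<And>e t. e \<in> Ed \<Longrightarrow> 0 \<le> t \<Longrightarrow> t \<le> len e \<Longrightarrow> (u e t)\<^sup>2 \<le> X" for X
    proof -
      have "P \<le> (\<Sum>e\<in>Ed. X powr q * K.edge_mass e)"
        unfolding P_def K.edge_mass_def q_def
        using that by (intro sum_mono powr_integral_bound(2) assms K.edge_integrable) auto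
      then show ?thesis by (simp add: m_def sum_distrib_left)
    qed
    have Ph_bounds: "Ph \<le> X powr q * mh" if "\<And>t. 0 \<le> t \<Longrightarrow> (uh t)\<^sup>2 \<le> X" for X
      unfolding Ph_def mh_def q_def
      using that by (intro powr_integral_bound(2) assms weak_deriv_halflineD(3)[OF H1(2)]) auto
    have PT: "P + Ph \<le> (4 * \<mu> / h + 4 * h * T) powr q * \<mu>" if "0 < h" for h
      using P_bounds[of "4 * \<mu> / h + 4 * h * T"] Ph_bounds[of "4 * \<mu> / h + 4 * h * T"]
        sup_K sup_h that by (simp flip: mass add: distrib_left)
    have "T \<le> (4 * \<mu> / h + 4 * h * T) powr q * \<mu>" if "0 < h" for h
    proof -
      \<comment> \<open>Nonpositive energy bounds the kinetic integral by \<open>2 / p < 1\<close>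
        times the nonlinear one, which closes the Gagliardo--Nirenberg loop.\<close>
      have "E \<le> 0" using E_upper th mu lam by (smt (verit) mult_nonneg_nonneg zero_le_power2 mult_minus_left)
      then have "T \<le> 2 / p * (P + Ph)" unfolding E_eq T_def by (simp add: field_simps)
      also have "\<dots> \<le> 1 * (P + Ph)" using assms nn by (intro mult_right_mono) auto
      finally show ?thesis using PT[OF that] by simp
    qed
    from kinetic_bound[OF q mu lam scal this] have T_le: "T \<le> c1 * (\<mu> * \<Lambda>\<^sup>2)" by (simp add: c1_def)
    \<comment> \<open>The natural length \<open>h = 1 / \<Lambda>\<close> is inserted.\<close>
    have h1: "4 * \<mu> / (1 / \<Lambda>) + 4 * (1 / \<Lambda>) * T \<le> B1 * \<mu> * \<Lambda>"
    proof -
      have "1 / \<Lambda> * T \<le> 1 / \<Lambda> * (c1 * (\<mu> * \<Lambda>\<^sup>2))" using T_le lam by (intro mult_left_mono) auto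
      also have "\<dots> = c1 * \<mu> * \<Lambda>" using lam by (simp add: power2_eq_square)
      finally have "1 / \<Lambda> * T \<le> c1 * \<mu> * \<Lambda>" .
      moreover have "4 * \<mu> / (1 / \<Lambda>) + 4 * (1 / \<Lambda>) * T = 4 * \<mu> * \<Lambda> + 4 * (1 / \<Lambda> * T)" by simp
      moreover have "B1 * \<mu> * \<Lambda> = 4 * \<mu> * \<Lambda> + 4 * (c1 * \<mu> * \<Lambda>)" by (simp add: B1_def algebra_simps)
      ultimately show ?thesis by linarith
    qed
    have "B1 * (\<mu> * \<Lambda>) \<le> C * (\<mu> * \<Lambda>)" using C mu lam by (intro mult_right_mono) auto
    then have sup_C: "(uh t)\<^sup>2 \<le> C * \<mu> * \<Lambda>" if "0 \<le> t" for t
      using sup_h[OF that, of "1 / \<Lambda>"] h1 lam by (simp add: mult.assoc)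
    have E_lower: "- C * \<mu> * \<Lambda>\<^sup>2 \<le> E"
    proof -
      have "0 \<le> T" using nn by (simp add: T_def)
      have "P + Ph \<le> (4 * \<mu> / (1 / \<Lambda>) + 4 * (1 / \<Lambda>) * T) powr q * \<mu>" using PT[of "1 / \<Lambda>"] lam by simp
      also have "\<dots> \<le> (B1 * \<mu> * \<Lambda>) powr q * \<mu>"
        using h1 q mu lam \<open>0 \<le> T\<close> by (intro mult_right_mono powr_mono2) auto
      also have "\<dots> = B1 powr q * (\<mu> * \<Lambda>\<^sup>2)" using scal'[of B1] c1 by (simp add: B1_def mult_ac)
      also have "\<dots> \<le> C * (\<mu> * \<Lambda>\<^sup>2)" using C mu by (intro mult_right_mono) auto
      finally have 1: "P + Ph \<le> C * (\<mu> * \<Lambda>\<^sup>2)" .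
      have "(P + Ph) / p \<le> (P + Ph) / 1" using assms nn by (intro divide_left_mono) auto
      with 1 have "(P + Ph) / p \<le> C * (\<mu> * \<Lambda>\<^sup>2)" by simp
      from le_imp_neg_le[OF this] have "- (C * (\<mu> * \<Lambda>\<^sup>2)) \<le> (D + Dh) / 2 - (P + Ph) / p"
        by (rule order_trans) (use nn in simp)
      then show ?thesis unfolding E_eq by (simp add: mult.assoc)
    qed
    interpret level: minimal_level p \<mu> \<Lambda> E \<theta> C
      using assms mu lam scal th E_upper C E_lower minimal by unfold_locales (auto simp: q_def)

    \<comment> \<open>Smallness on the core and conclusion\<close>
    have point: "(u e t)\<^sup>2 \<le> 2 * m / L + 18 * d * D" if "(e, t) \<in> graph_points Ed len" for e t
      using K.point_square_bound[OF that d] by (simp add: m_def D_def L_def)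
    have "2 * m / L + 18 * d * D \<le> \<eta> * \<mu> * \<Lambda>"
    proof -
      have "m * (1 / L) \<le> \<mu> * (\<epsilon> * \<Lambda>)" using mass_ge L_le nn mu L by (intro mult_mono) auto
      moreover have "d * D \<le> d * (C * (\<mu> * \<Lambda>\<^sup>2))"
      proof (rule mult_left_mono[OF _ d0])
        have "c1 * (\<mu> * \<Lambda>\<^sup>2) \<le> C * (\<mu> * \<Lambda>\<^sup>2)" using C mu by (intro mult_right_mono) auto
        with T_le show "D \<le> C * (\<mu> * \<Lambda>\<^sup>2)" using nn by (simp add: T_def)
      qed
      moreover have "d * (C * (\<mu> * \<Lambda>\<^sup>2)) = (\<Lambda> * d) * (C * \<mu> * \<Lambda>)" by (simp add: power2_eq_square)
      moreover have "(\<Lambda> * d) * (C * \<mu> * \<Lambda>) \<le> \<epsilon> * (C * \<mu> * \<Lambda>)"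
        using d_le C mu lam by (intro mult_right_mono) auto
      ultimately have "2 * m / L + 18 * d * D \<le> 2 * (\<mu> * (\<epsilon> * \<Lambda>)) + 18 * (\<epsilon> * (C * \<mu> * \<Lambda>))" by simp
      also have "\<dots> = \<eta> * \<mu> * \<Lambda>" unfolding eps_eta[symmetric] by (simp add: algebra_simps)
      finally show ?thesis .
    qed
    then have P_le: "P \<le> (\<eta> * \<mu> * \<Lambda>) powr ((p - 2) / 2) * m"
      unfolding q_def[symmetric] using point
      by (intro P_bounds) (fastforce simp: graph_points_def)
    \<comment> \<open>\<open>uh 0\<close> is the value at \<open>v0\<close>, itself a point of the
      core, so the pointwise bound there applies.\<close>
    have bdry: "\<Lambda> * (uh 0)\<^sup>2 \<le> \<eta> * (\<Lambda>\<^sup>2 * m + D)"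
    proof -
      obtain e t where "(e, t) \<in> graph_points Ed len" "u e t = uh 0"
        using K.vertex_is_point[OF v0] H1(4) by metis
      then have "(uh 0)\<^sup>2 \<le> 2 * m / L + 18 * d * D" using point by metis
      then have "\<Lambda> * (uh 0)\<^sup>2 \<le> \<Lambda> * (2 * m / L + 18 * d * D)" using lam by simp
      also have "\<dots> = 2 * (\<Lambda> * m * (1 / L)) + 18 * ((\<Lambda> * d) * D)" by (simp add: algebra_simps)
      also have "\<dots> \<le> 2 * (\<Lambda> * m * (\<epsilon> * \<Lambda>)) + 18 * (\<epsilon> * D)"
        using L_le d_le nn lam by (intro add_mono mult_left_mono mult_right_mono) auto
      also have "\<dots> = 2 * \<epsilon> * (\<Lambda>\<^sup>2 * m) + 18 * \<epsilon> * D" by (simp add: power2_eq_square)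
      also have "\<dots> \<le> \<eta> * (\<Lambda>\<^sup>2 * m) + \<eta> * D"
      proof -
        have "1 * \<epsilon> \<le> C * \<epsilon>" using C eps by (intro mult_right_mono) auto
        then have "2 * \<epsilon> \<le> \<eta>" "18 * \<epsilon> \<le> \<eta>" using eps_eta eps by (auto simp: algebra_simps)
        then show ?thesis using nn by (intro add_mono mult_right_mono) auto
      qed
      finally show ?thesis by (simp add: distrib_left)
    qed
    have mh: "(LBINT t:{0..}. (uh t)\<^sup>2) = \<mu> - m" using mass by (simp add: mh_def)
    \<comment> \<open>The whole core serves as the head. Once it carries neither mass nor kinetic
      energy, \<open>uh\<close> is a minimizer on the halfline vanishing at 0, which is
      impossible.\<close>
    have "D = 0" "m = 0"
      using level.head_vanishes[OF H1(2) mh nn(1) sup_C E_split nn(2) P_le bdry small] by auto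
    moreover from this have "uh 0 = 0" "P = 0" using bdry P_le nn lam by (auto simp: mult_le_0_iff)
    ultimately show False
      using level.no_halfline_minimizer[OF H1(2) _ _ sup_C _ small] mh E_split by simp
  qed
  then show ?thesis using eps by blast
qed

end
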